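(* Let $(N_t)_{t\ge0}$ be a branching process on $\mathbb N_0^*$ with transition kernels $(\ell_{s,t})$ and probability generating functions $(F_{s,t})_{(s,t)\in\Delta}$. The following are equivalent: (i) $(N_t)$ is spatially embeddable into a branching process on $[0,\infty]$; (ii) $F_{s,t}(0)=0$ for all $(s,t)\in\Delta$; (iii) $\ell_{s,t}(n,\{m\})=0$ for all $(s,t)\in\Delta$ and $m,n\in\mathbb N_0$ with $m<n$; (iv) $\mathbb P^{(s,n)}[N_t\le N_u]=1$ for all $0\le s\le t\le u$ and $n\in\mathbb N_0$.
   Context: $\Delta=\{(s,t):0\le s\le t\}$, $\mathbb N_0^*=\{0,1,2,\dots\}\cup\{\infty\}$ with its natural compact topology; $(k\star l)(x,B)=\int l(y,B)k(x,\mathrm dy)$, $\ast$ = convolution. A branching process on $\mathbb N_0^*$ is a Markov family $(N_t)$ (probabilities $\mathbb P^{(s,n)}$ with $\mathbb P^{(s,n)}[N_s=n]=1$ and $\mathbb E^{(s,n)}[f(N_u)|\mathcal F_{[s,t]}]=\int f(y)\ell_{t,u}(N_t,\mathrm dy)$ a.s.) whose transition kernels $(\ell_{s,t})$ on $\mathbb N_0^*$ satisfy: $\ell_{s,s}(n,\cdot)=\delta_n$; $\ell_{s,t}\star\ell_{t,u}=\ell_{s,u}$; for $n\in\mathbb N_0$, $(s,t)\mapsto\ell_{s,t}(n,\cdot)$ weakly continuous; $\ell_{s,t}(m,\cdot)\ast\ell_{s,t}(n,\cdot)=\ell_{s,t}(m+n,\cdot)$ for $m,n\in\mathbb N_0$;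 $\ell_{s,t}(0,\cdot)=\delta_0$; $\ell_{s,t}(\infty,\cdot)=\delta_\infty$. Probability generating functions: $F_{s,t}(z)=\sum_{n\ge0}\ell_{s,t}(1,\{n\})z^n$, $|z|<1$. A family of transition kernels of a branching process on $[0,\infty]$ is a family $(k_{s,t})$ of transition kernels on $[0,\infty]$ with $k_{s,s}(x,\cdot)=\delta_x$, $k_{s,t}\star k_{t,u}=k_{s,u}$, weak continuity of $(s,t,x)\mapsto k_{s,t}(x,\cdot)$ on $\Delta\times[0,\infty)$, $k_{s,t}(x,\cdot)\ast k_{s,t}(y,\cdot)=k_{s,t}(x+y,\cdot)$ for $x,y\in[0,\infty)$, $k_{s,t}(0,\cdot)=\delta_0$, $k_{s,t}(\infty,\cdot)=\delta_\infty$. $(N_t)$ is spatially embeddable into a branching process on $[0,\infty]$ if there is such a family $(k_{s,t})$ with $k_{s,t}(n,B)=\ell_{s,t}(n,B\cap\mathbb N_0^* )$ for all $n\in\mathbb N_0^*$, $(s,t)\in\Delta$ and Borel $B\subset[0,\infty]$. *)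

theory Defs
  imports "HOL-Probability.Probability"
begin

definition Delta :: "(real \<times> real) set" where
  "Delta = {(s, t). 0 \<le> s \<and> s \<le> t}"

definition conv_pmf :: "enat pmf \<Rightarrow> enat pmf \<Rightarrow> enat pmf" where
  "conv_pmf p q = map_pmf (\<lambda>(a, b). a + b) (pair_pmf p q)"

definition conv_meas :: "ennreal measure \<Rightarrow> ennreal measure \<Rightarrow> ennreal measure" where
  "conv_meas M M' = distr (M \<Otimes>\<^sub>M M') borel (\<lambda>(a, b). a + b)"

definition pgf :: "enat pmf \<Rightarrow> real \<Rightarrow> real" where
  "pgf p z = (\<Sum>n. pmf p (enat n) * z ^ n)"

definition branching_kernels_enat :: "(real \<Rightarrow> real \<Rightarrow> enat \<Rightarrow> enat pmf) \<Rightarrow> bool" where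
  "branching_kernels_enat l \<longleftrightarrow>
     (\<forall>s n. 0 \<le> s \<longrightarrow> l s s n = return_pmf n) \<and>
     (\<forall>s t u n. 0 \<le> s \<longrightarrow> s \<le> t \<longrightarrow> t \<le> u \<longrightarrow> bind_pmf (l s t n) (l t u) = l s u n) \<and>
     (\<forall>n::nat. \<forall>f :: enat \<Rightarrow> real. continuous_on UNIV f \<longrightarrow>
        continuous_on Delta (\<lambda>(s, t). measure_pmf.expectation (l s t (enat n)) f)) \<and>
     (\<forall>s t m n. (s, t) \<in> Delta \<longrightarrow>
        conv_pmf (l s t (enat m)) (l s t (enat n)) = l s t (enat (m + n))) \<and>
     (\<forall>s t. (s, t) \<in> Delta \<longrightarrow> l s t 0 = return_pmf 0) \<and>
     (\<forall>s t. (s, t) \<in> Delta \<longrightarrow> l s t \<infinity> = return_pmf \<infinity>)"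

definition filt :: "'w measure \<Rightarrow> (real \<Rightarrow> 'w \<Rightarrow> enat) \<Rightarrow> real \<Rightarrow> real \<Rightarrow> 'w measure" where
  "filt \<Omega> N s t = sigma (space \<Omega>) {N r -` B \<inter> space \<Omega> | r B. r \<in> {s..t}}"

text \<open>Markov family with transition kernels l: the conditional expectation identity
  E^(s,n)[f(N_u) | F_[s,t]] = int f(y) l_(t,u)(N_t, dy) a.s., written out for indicator f
  via the defining property of conditional expectation.\<close>
definition markov_family ::
  "'w measure \<Rightarrow> (real \<Rightarrow> 'w \<Rightarrow> enat) \<Rightarrow> (real \<Rightarrow> enat \<Rightarrow> 'w measure)
     \<Rightarrow> (real \<Rightarrow> real \<Rightarrow> enat \<Rightarrow> enat pmf) \<Rightarrow> bool" where
  "markov_family \<Omega> N P l \<longleftrightarrow>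
     (\<forall>t\<ge>0. N t \<in> measurable \<Omega> (count_space UNIV)) \<and>
     (\<forall>s\<ge>0. \<forall>n. prob_space (P s n) \<and> sets (P s n) = sets \<Omega> \<and>
        measure (P s n) {\<omega> \<in> space \<Omega>. N s \<omega> = n} = 1) \<and>
     (\<forall>s t u n A B. 0 \<le> s \<longrightarrow> s \<le> t \<longrightarrow> t \<le> u \<longrightarrow> A \<in> sets (filt \<Omega> N s t) \<longrightarrow>
        measure (P s n) (A \<inter> {\<omega> \<in> space \<Omega>. N u \<omega> \<in> B}) =
        (\<integral>\<omega>. indicator A \<omega> * measure_pmf.prob (l t u (N t \<omega>)) B \<partial>P s n))"

definition branching_process ::
  "'w measure \<Rightarrow> (real \<Rightarrow> 'w \<Rightarrow> enat) \<Rightarrow> (real \<Rightarrow> enat \<Rightarrow> 'w measure)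
     \<Rightarrow> (real \<Rightarrow> real \<Rightarrow> enat \<Rightarrow> enat pmf) \<Rightarrow> bool" where
  "branching_process \<Omega> N P l \<longleftrightarrow> markov_family \<Omega> N P l \<and> branching_kernels_enat l"

definition branching_kernels_ennreal :: "(real \<Rightarrow> real \<Rightarrow> ennreal \<Rightarrow> ennreal measure) \<Rightarrow> bool" where
  "branching_kernels_ennreal k \<longleftrightarrow>
     (\<forall>s t x. (s, t) \<in> Delta \<longrightarrow> prob_space (k s t x) \<and> sets (k s t x) = sets borel) \<and>
     (\<forall>s t B. (s, t) \<in> Delta \<longrightarrow> B \<in> sets borel \<longrightarrow>
        (\<lambda>x. emeasure (k s t x) B) \<in> borel_measurable borel) \<and>
     (\<forall>s x. 0 \<le> s \<longrightarrow> k s s x = return borel x) \<and>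
     (\<forall>s t u x B. 0 \<le> s \<longrightarrow> s \<le> t \<longrightarrow> t \<le> u \<longrightarrow> B \<in> sets borel \<longrightarrow>
        (\<integral>\<^sup>+ y. emeasure (k t u y) B \<partial>k s t x) = emeasure (k s u x) B) \<and>
     (\<forall>f :: ennreal \<Rightarrow> real. continuous_on UNIV f \<longrightarrow>
        continuous_on {(s, t, x). (s, t) \<in> Delta \<and> x \<noteq> \<infinity>}
          (\<lambda>(s, t, x). \<integral>y. f y \<partial>k s t x)) \<and>
     (\<forall>s t x y. (s, t) \<in> Delta \<longrightarrow> x \<noteq> \<infinity> \<longrightarrow> y \<noteq> \<infinity> \<longrightarrow>
        conv_meas (k s t x) (k s t y) = k s t (x + y)) \<and>
     (\<forall>s t. (s, t) \<in> Delta \<longrightarrow> k s t 0 = return borel 0) \<and>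
     (\<forall>s t. (s, t) \<in> Delta \<longrightarrow> k s t \<infinity> = return borel \<infinity>)"

definition spatially_embeddable :: "(real \<Rightarrow> real \<Rightarrow> enat \<Rightarrow> enat pmf) \<Rightarrow> bool" where
  "spatially_embeddable l \<longleftrightarrow>
     (\<exists>k. branching_kernels_ennreal k \<and>
        (\<forall>s t n B. (s, t) \<in> Delta \<longrightarrow> B \<in> sets borel \<longrightarrow>
           emeasure (k s t (ennreal_of_enat n)) B =
           emeasure (measure_pmf (l s t n)) {m. ennreal_of_enat m \<in> B}))"

end

theory Submission
  imports Defs "HOL-Computational_Algebra.Formal_Power_Series"
begin

text \<open>
  Write \<open>F\<close> for the generating function of \<open>l s t 1\<close>. If \<open>F(0) = 0\<close>, then
  \<open>F(z) = a z G(z)\<close> with \<open>G(0) = 1\<close>, and the embedding kernel at \<open>x\<close> must have the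
  generating function \<open>F(z)^x = z^x a^x G(z)^x\<close>; the issue is that \<open>G^x\<close> has nonnegative
  coefficients. This holds once those of \<open>D = G'/G\<close> are nonnegative. The flow equation gives
  \<open>D_{s,u} = (D_{s,t} \<circ> F_{t,u}) F_{t,u}' + D_{t,u}\<close>. Hence, by induction on \<open>n\<close>, the negative part
  of the \<open>n\<close>-th coefficient is subadditive over adjacent intervals, while on short intervals it is
  of order \<open>(1 - a)^2\<close>. As \<open>-ln a\<close> is additive, summing over ever finer partitions makes it vanish.

  Conversely, suppose that a process embedded in \<open>k\<close> can die out. Let \<open>v\<close> be the last time until
  which a process started at time \<open>s\<close> from one individual cannot die. For \<open>u > v\<close> the law
  \<open>k v u 1 = k v u (1/2) * k v u (1/2)\<close> lives on the lattice and charges 0, so \<open>k v u (1/2)\<close> also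
  lives on the lattice. This contradicts weak convergence to the point mass at \<open>1/2\<close> as \<open>u\<close>
  decreases to \<open>v\<close>.
\<close>

section \<open>Real powers of formal power series\<close>

unbundle fps_syntax
unbundle no vec_syntax

text \<open>The binomial series \<open>(1 + X)^x\<close> substituted at \<open>H - 1\<close>, which
  is the power \<open>H^x\<close> when \<open>H $ 0 = 1\<close>. Its coefficients are polynomials in
  \<open>x\<close>.\<close>

definition fps_rpow :: "real fps \<Rightarrow> real \<Rightarrow> real fps" where
  "fps_rpow H x = fps_binomial x oo (H - 1)"

definition fps_logderiv :: "real fps \<Rightarrow> real fps" where
  "fps_logderiv H = fps_deriv H * inverse H"

lemma fps_rpow_nth: "fps_rpow H x $ n = (\<Sum>i=0..n. (x gchoose i) * ((H - 1) ^ i $ n))"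
  by (simp add: fps_rpow_def fps_compose_nth)

lemma fps_rpow_nth_0 [simp]: "fps_rpow H x $ 0 = 1"
  by (simp add: fps_rpow_def)

lemma fps_rpow_add:
  assumes "H $ 0 = 1"
  shows "fps_rpow H (x + y) = fps_rpow H x * fps_rpow H y"
  unfolding fps_rpow_def fps_binomial_add_mult
  by (rule fps_compose_mult_distrib) (simp add: assms)

lemma fps_rpow_of_nat:
  assumes "H $ 0 = 1"
  shows "fps_rpow H (real m) = H ^ m"
  using assms
  by (simp add: fps_rpow_def fps_binomial_of_nat fps_compose_power[symmetric]
      fps_compose_add_distrib fps_X_fps_compose_startby0)

lemma fps_rpow_deriv:
  assumes H: "H $ 0 = 1"
  shows "fps_deriv (fps_rpow H x) = fps_const x * fps_rpow H x * fps_logderiv H"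
proof -
  have H0: "(H - 1) $ 0 = 0"
    using H by simp
  have "fps_deriv (fps_rpow H x) = (fps_deriv (fps_binomial x) oo (H - 1)) * fps_deriv (H - 1)"
    unfolding fps_rpow_def by (rule fps_compose_deriv[OF H0])
  also have "fps_deriv (fps_binomial x) = fps_const x * fps_binomial x * inverse (1 + fps_X)"
    by (simp add: fps_binomial_deriv fps_divide_unit)
  also have "\<dots> oo (H - 1) = fps_const x * fps_rpow H x * inverse H"
    using H0
    by (simp add: fps_compose_mult_distrib fps_rpow_def fps_inverse_compose fps_compose_add_distrib
        fps_X_fps_compose_startby0)
  finally show ?thesis
    by (simp add: fps_logderiv_def mult_ac)
qed

text \<open>The coefficient of degree \<open>m\<close> in the equation determines
  \<open>A $ Suc m\<close> from the earlier coefficients of \<open>A\<close>.\<close>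

lemma fps_linear_ODE_unique:
  fixes A B D :: "real fps"
  assumes "fps_deriv A = A * D" "fps_deriv B = B * D" "A $ 0 = B $ 0"
  shows "A = B"
proof -
  have "A $ n = B $ n" for n
  proof (induction n rule: less_induct)
    case (less n)
    show ?case
    proof (cases n)
      case 0
      then show ?thesis using assms by simp
    next
      case (Suc m)
      have "real (Suc m) * A $ Suc m = (\<Sum>i=0..m. A $ i * D $ (m - i))"
        using arg_cong[OF assms(1), of "\<lambda>f. f $ m"] by (simp add: fps_mult_nth)
      also have "\<dots> = (\<Sum>i=0..m. B $ i * D $ (m - i))"
        using less Suc by (intro sum.cong) auto
      also have "\<dots> = real (Suc m) * B $ Suc m"
        using arg_cong[OF assms(2), of "\<lambda>f. f $ m"] by (simp add: fps_mult_nth)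
      finally show ?thesis using Suc by simp
    qed
  qed
  then show ?thesis by (simp add: fps_eq_iff)
qed

lemma fps_logderiv_mult:
  assumes "A $ 0 = 1" "B $ 0 = 1"
  shows "fps_logderiv (A * B) = fps_logderiv A + fps_logderiv B"
proof -
  have A: "A * inverse A = 1" and B: "B * inverse B = 1"
    using assms by (simp_all add: inverse_mult_eq_1')
  have "fps_logderiv (A * B)
      = fps_deriv A * inverse A * (B * inverse B) + fps_deriv B * inverse B * (A * inverse A)"
    using assms by (simp add: fps_logderiv_def fps_inverse_mult algebra_simps)
  then show ?thesis
    unfolding A B by (simp add: fps_logderiv_def)
qed

lemma fps_logderiv_compose:
  assumes "A $ 0 = 1" "F $ 0 = 0"
  shows "fps_logderiv (A oo F) = (fps_logderiv A oo F) * fps_deriv F"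
  using assms
  by (simp add: fps_logderiv_def fps_compose_deriv fps_compose_mult_distrib fps_inverse_compose mult_ac)

text \<open>Both sides start with 1 and solve the same linear equation, because the logarithmic
  derivative is additive over products.\<close>

lemma fps_rpow_mult:
  assumes "A $ 0 = 1" "B $ 0 = 1"
  shows "fps_rpow (A * B) x = fps_rpow A x * fps_rpow B x"
proof (rule fps_linear_ODE_unique)
  show "fps_deriv (fps_rpow (A * B) x) = fps_rpow (A * B) x * (fps_const x * fps_logderiv (A * B))"
    using assms by (simp add: fps_rpow_deriv mult_ac)
  show "fps_deriv (fps_rpow A x * fps_rpow B x)
      = fps_rpow A x * fps_rpow B x * (fps_const x * fps_logderiv (A * B))"
    using assms by (simp add: fps_rpow_deriv fps_logderiv_mult algebra_simps)
qed simp

lemma fps_rpow_compose: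
  assumes "A $ 0 = 1" "F $ 0 = 0"
  shows "fps_rpow (A oo F) x = fps_rpow A x oo F"
proof -
  have "(A oo F) - 1 = (A - 1) oo F"
    by (simp add: fps_compose_sub_distrib)
  then show ?thesis
    using assms unfolding fps_rpow_def by (simp add: fps_compose_assoc)
qed

text \<open>With \<open>D = fps_logderiv H\<close>, the equation \<open>(H^x)' = x H^x D\<close> is
  a recursion for the coefficients of \<open>H^x\<close> in which only nonnegative terms
  occur.\<close>

lemma fps_rpow_nonneg:
  assumes H: "H $ 0 = 1" and D: "\<And>n. 0 \<le> fps_logderiv H $ n" and x: "0 \<le> x"
  shows "0 \<le> fps_rpow H x $ n"
proof (induction n rule: less_induct)
  case (less n)
  show ?case
  proof (cases n)
    case (Suc m)
    have "fps_deriv (fps_rpow H x) = fps_const x * (fps_rpow H x * fps_logderiv H)"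
      using H by (simp add: fps_rpow_deriv mult_ac)
    then have "fps_deriv (fps_rpow H x) $ m = x * (\<Sum>i=0..m. fps_rpow H x $ i * fps_logderiv H $ (m - i))"
      by (simp only: fps_mult_left_const_nth, simp only: fps_mult_nth)
    also have "\<dots> \<ge> 0"
      using less Suc D x by (intro mult_nonneg_nonneg sum_nonneg) auto
    finally have "0 \<le> real (Suc m) * fps_rpow H x $ Suc m"
      by simp
    then have "0 \<le> fps_rpow H x $ Suc m"
      by (simp only: zero_le_mult_iff) auto
    then show ?thesis using Suc by simp
  qed simp
qed

section \<open>Coefficient estimates for products, powers and compositions\<close>

lemma fps_mult_partial_sum_le:
  fixes A B :: "real fps"
  assumes "\<And>n. 0 \<le> A $ n" "\<And>n. 0 \<le> B $ n"
  shows "(\<Sum>n\<le>N. (A * B) $ n) \<le> (\<Sum>n\<le>N. A $ n) * (\<Sum>n\<le>N. B $ n)"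
proof -
  have "(\<Sum>n\<le>N. (A * B) $ n) = (\<Sum>(i, j)\<in>{(i, j). i + j \<le> N}. A $ i * B $ j)"
    by (simp add: fps_mult_nth atLeast0AtMost sum.triangle_reindex_eq)
  also have "\<dots> \<le> (\<Sum>(i, j)\<in>{..N} \<times> {..N}. A $ i * B $ j)"
    using assms by (intro sum_mono2) auto
  also have "\<dots> = (\<Sum>n\<le>N. A $ n) * (\<Sum>n\<le>N. B $ n)"
    by (simp add: sum_product sum.cartesian_product)
  finally show ?thesis .
qed

text \<open>The rectangle of index pairs with \<open>i \<le> M\<close> and \<open>j \<le> N\<close>
  lies in the triangle \<open>i + j \<le> M + N\<close>.\<close>

lemma fps_mult_partial_sum_ge:
  fixes A B :: "real fps"
  assumes "\<And>n. 0 \<le> A $ n" "\<And>n. 0 \<le> B $ n"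
  shows "(\<Sum>n\<le>M. A $ n) * (\<Sum>n\<le>N. B $ n) \<le> (\<Sum>n\<le>M + N. (A * B) $ n)"
proof -
  have fin: "finite {(i, j). i + j \<le> M + N}"
    by (rule finite_subset[of _ "{..M + N} \<times> {..M + N}"]) auto
  have "(\<Sum>n\<le>M. A $ n) * (\<Sum>n\<le>N. B $ n) = (\<Sum>(i, j)\<in>{..M} \<times> {..N}. A $ i * B $ j)"
    by (simp add: sum_product sum.cartesian_product)
  also have "\<dots> \<le> (\<Sum>(i, j)\<in>{(i, j). i + j \<le> M + N}. A $ i * B $ j)"
    using assms fin by (intro sum_mono2) auto
  also have "\<dots> = (\<Sum>n\<le>M + N. (A * B) $ n)"
    by (simp add: fps_mult_nth atLeast0AtMost sum.triangle_reindex_eq)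
  finally show ?thesis .
qed

lemma fps_power_nonneg:
  fixes A :: "real fps"
  assumes "\<And>n. 0 \<le> A $ n"
  shows "0 \<le> (A ^ m) $ n"
  by (induction m arbitrary: n) (auto simp: fps_mult_nth assms intro!: sum_nonneg mult_nonneg_nonneg)

lemma fps_power_partial_sum_le_1:
  fixes A :: "real fps"
  assumes "\<And>n. 0 \<le> A $ n" "\<And>N. (\<Sum>n\<le>N. A $ n) \<le> 1"
  shows "(\<Sum>n\<le>N. (A ^ m) $ n) \<le> 1"
proof (induction m)
  case 0
  have "(\<Sum>n\<le>N. (1 :: real fps) $ n) = 1"
    by (simp add: sum.If_cases)
  then show ?case by simp
next
  case (Suc m)
  have "(\<Sum>n\<le>N. (A ^ Suc m) $ n) \<le> (\<Sum>n\<le>N. A $ n) * (\<Sum>n\<le>N. (A ^ m) $ n)"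
    using fps_mult_partial_sum_le[of A "A ^ m"] assms fps_power_nonneg[of A] by simp
  also have "\<dots> \<le> 1"
    using Suc assms fps_power_nonneg[of A] by (intro mult_le_one sum_nonneg) auto
  finally show ?case .
qed

lemma fps_mult_compose_nth:
  fixes A B F :: "real fps"
  assumes "F $ 0 = 0"
  shows "(A * (B oo F)) $ n = (\<Sum>i=0..n. B $ i * (A * F ^ i) $ n)"
proof -
  \<comment> \<open>The inner sums may run up to \<open>n\<close> instead of \<open>n - j\<close>,
    since \<open>F ^ i\<close> has no coefficient below degree \<open>i\<close>.\<close>
  have "(A * (B oo F)) $ n = (\<Sum>j=0..n. A $ j * (\<Sum>i=0..n. B $ i * (F ^ i $ (n - j))))"
    unfolding fps_mult_nth fps_compose_nth using assms
    by (intro sum.cong refl arg_cong2[where f="(*)"] sum.mono_neutral_left)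
       (auto simp: startsby_zero_power_prefix)
  also have "\<dots> = (\<Sum>i=0..n. B $ i * (\<Sum>j=0..n. A $ j * (F ^ i $ (n - j))))"
    by (simp add: sum_distrib_left mult_ac) (rule sum.swap)
  finally show ?thesis by (simp add: fps_mult_nth)
qed

lemma continuous_on_fps_power_nth:
  fixes A :: "'a::topological_space \<Rightarrow> real fps"
  assumes "\<And>n. continuous_on S (\<lambda>z. A z $ n)"
  shows "continuous_on S (\<lambda>z. (A z ^ m) $ n)"
proof (induction m arbitrary: n)
  case (Suc m)
  then show ?case
    by (auto simp: fps_mult_nth intro!: continuous_intros assms)
qed auto

text \<open>Local-to-global principle for properties of intervals. An interval shorter than
  \<open>(n + 2) d\<close> is cut at the fraction \<open>(n + 1) / (n + 2)\<close> of its length,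
  which leaves pieces shorter than \<open>(n + 1) d\<close> and \<open>d\<close>.\<close>

lemma interval_chain_induct:
  fixes P :: "real \<Rightarrow> real \<Rightarrow> bool" and d :: real
  assumes d: "0 < d"
    and small: "\<And>s t. S \<le> s \<Longrightarrow> s \<le> t \<Longrightarrow> t \<le> T \<Longrightarrow> t - s < d \<Longrightarrow> P s t"
    and chain: "\<And>s t u. S \<le> s \<Longrightarrow> s \<le> t \<Longrightarrow> t \<le> u \<Longrightarrow> u \<le> T \<Longrightarrow> P s t \<Longrightarrow> P t u \<Longrightarrow> P s u"
    and "S \<le> T"
  shows "P S T"
proof -
  have *: "P s t" if "S \<le> s" "s \<le> t" "t \<le> T" "t - s < real (Suc n) * d" for n s t
    using that
  proof (induction n arbitrary: s t)
    case 0
    then show ?case using small by simp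
  next
    case (Suc n)
    define w where "w = real (Suc n) / real (Suc (Suc n))"
    define r where "r = s + (t - s) * w"
    have w: "0 \<le> w" "w \<le> 1" "w > 0"
      by (auto simp: w_def)
    have r: "s \<le> r" "r \<le> t"
      using Suc.prems w mult_left_mono[OF w(2), of "t - s"] by (auto simp: r_def)
    have "r - s < (real (Suc (Suc n)) * d) * w"
      unfolding r_def using mult_strict_right_mono[OF Suc.prems(4) w(3)] by simp
    also have "\<dots> = real (Suc n) * d"
      by (simp add: w_def field_simps)
    finally have "P s r"
      using Suc r by auto
    moreover have "t - r = (t - s) / real (Suc (Suc n))"
      by (simp add: r_def w_def field_simps)
    then have "t - r < d"
      using Suc.prems(4) by (simp add: pos_divide_less_eq mult_ac del: of_nat_Suc)
    then have "P r t"
      using r Suc.prems by (intro small) auto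
    ultimately show ?case
      using chain[of s r t] r Suc.prems by auto
  qed
  obtain n :: nat where "(T - S) / d < real n"
    using reals_Archimedean2 by blast
  then have "T - S < real n * d"
    using d by (simp add: field_simps)
  also have "\<dots> \<le> real (Suc n) * d"
    using d by simp
  finally show ?thesis
    using * assms by blast
qed

section \<open>Flows of generating functions\<close>

lemma Delta_iff: "(s, t) \<in> Delta \<longleftrightarrow> 0 \<le> s \<and> s \<le> t"
  by (simp add: Delta_def)

text \<open>Generating functions of one individual that cannot die. The coefficients sum to at most
  1 and not exactly to 1, since mass may escape to infinity.\<close>

locale pgf_flow =
  fixes F :: "real \<Rightarrow> real \<Rightarrow> real fps"
  assumes F_nth_0: "\<And>s t. (s, t) \<in> Delta \<Longrightarrow> F s t $ 0 = 0"
    and F_nonneg: "\<And>s t n. (s, t) \<in> Delta \<Longrightarrow> 0 \<le> F s t $ n"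
    and F_sum_le_1: "\<And>s t N. (s, t) \<in> Delta \<Longrightarrow> (\<Sum>n\<le>N. F s t $ n) \<le> 1"
    and F_refl: "\<And>s. 0 \<le> s \<Longrightarrow> F s s = fps_X"
    and F_compose: "\<And>s t u. 0 \<le> s \<Longrightarrow> s \<le> t \<Longrightarrow> t \<le> u \<Longrightarrow> F s u = F s t oo F t u"
    and F_cont: "\<And>n. continuous_on Delta (\<lambda>(s, t). F s t $ n)"
begin

definition a :: "real \<Rightarrow> real \<Rightarrow> real" where
  "a s t = F s t $ 1"

text \<open>The factor in \<open>F = a X G\<close>. Division by \<open>a\<close> normalises the
  constant coefficient to 1, as real powers of series require.\<close>

definition G :: "real \<Rightarrow> real \<Rightarrow> real fps" where
  "G s t = fps_const (1 / a s t) * fps_shift 1 (F s t)"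

lemma a_mult:
  assumes "0 \<le> s" "s \<le> t" "t \<le> u"
  shows "a s u = a s t * a t u"
  using assms F_nth_0[of s t] F_nth_0[of t u]
  by (simp add: a_def F_compose[OF assms] fps_compose_nth Delta_iff)

lemma a_refl [simp]: "0 \<le> s \<Longrightarrow> a s s = 1"
  by (simp add: a_def F_refl)

lemma a_nonneg: "(s, t) \<in> Delta \<Longrightarrow> 0 \<le> a s t"
  by (simp add: a_def F_nonneg)

lemma a_plus_nth_le_1:
  assumes "(s, t) \<in> Delta" "2 \<le> n"
  shows "a s t + F s t $ n \<le> 1"
proof -
  have "a s t + F s t $ n = (\<Sum>i\<in>{1, n}. F s t $ i)"
    using assms by (simp add: a_def)
  also have "\<dots> \<le> (\<Sum>i\<le>n. F s t $ i)"
    using assms F_nonneg by (intro sum_mono2) auto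
  finally show ?thesis
    using F_sum_le_1[OF assms(1), of n] by simp
qed

lemma a_le_1: "(s, t) \<in> Delta \<Longrightarrow> a s t \<le> 1"
  using a_plus_nth_le_1[of s t 2] F_nonneg[of s t 2] by simp

text \<open>On the diagonal \<open>a\<close> equals 1, and it is uniformly continuous on the compact
  triangle of pairs \<open>s \<le> t\<close> in \<open>[S, T]\<close>.\<close>

lemma a_near_diagonal:
  assumes "0 \<le> S" "0 < e"
  obtains d where "0 < d"
    "\<And>s t. S \<le> s \<Longrightarrow> s \<le> t \<Longrightarrow> t \<le> T \<Longrightarrow> t - s < d \<Longrightarrow> 1 - e < a s t"
proof -
  define K where "K = {S..T} \<times> {S..T} \<inter> {z. fst z \<le> snd z}"
  have "closed {z :: real \<times> real. fst z \<le> snd z}"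
    by (intro closed_Collect_le continuous_intros)
  then have "compact K"
    unfolding K_def by (intro compact_Int_closed compact_Times) auto
  moreover have "continuous_on K (\<lambda>(s, t). a s t)"
    unfolding a_def by (rule continuous_on_subset[OF F_cont]) (use assms in \<open>auto simp: K_def Delta_def\<close>)
  ultimately have "uniformly_continuous_on K (\<lambda>(s, t). a s t)"
    by (rule compact_uniformly_continuous[rotated])
  then obtain d where d: "0 < d"
    "\<And>z z'. z \<in> K \<Longrightarrow> z' \<in> K \<Longrightarrow> dist z' z < d \<Longrightarrow>
       dist ((\<lambda>(s, t). a s t) z') ((\<lambda>(s, t). a s t) z) < e"
    unfolding uniformly_continuous_on_def using assms(2) by blast
  have "1 - e < a s t" if "S \<le> s" "s \<le> t" "t \<le> T" "t - s < d" for s t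
  proof -
    have "dist (a s t) (a s s) < e"
      using d(2)[of "(s, s)" "(s, t)"] that by (simp add: K_def dist_prod_def dist_real_def)
    then show ?thesis
      using that assms by (simp add: dist_real_def)
  qed
  then show ?thesis using that d(1) by blast
qed

text \<open>On short intervals \<open>a\<close> is close to 1, and \<open>a_mult\<close> carries
  positivity along a chain of them.\<close>

lemma a_pos:
  assumes "(s, t) \<in> Delta"
  shows "0 < a s t"
proof -
  obtain d where d: "0 < d"
    "\<And>s' t'. s \<le> s' \<Longrightarrow> s' \<le> t' \<Longrightarrow> t' \<le> t \<Longrightarrow> t' - s' < d \<Longrightarrow> 1 - 1 < a s' t'"
    using a_near_diagonal[of s 1 t] assms by (auto simp: Delta_iff)
  show ?thesis
  proof (rule interval_chain_induct[where d=d and S=s and T=t and P="\<lambda>s t. 0 < a s t"])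
    fix s' t' u assume *: "s \<le> s'" "s' \<le> t'" "t' \<le> u" and "0 < a s' t'" "0 < a t' u"
    moreover have "a s' u = a s' t' * a t' u"
      using * assms by (intro a_mult) (auto simp: Delta_iff)
    ultimately show "0 < a s' u" by simp
  qed (use d assms in \<open>auto simp: Delta_iff\<close>)
qed

lemma G_nth: "G s t $ n = F s t $ Suc n / a s t"
  by (simp add: G_def)

lemma G_nth_0 [simp]: "(s, t) \<in> Delta \<Longrightarrow> G s t $ 0 = 1"
  using a_pos[of s t] by (simp add: G_nth a_def)

lemma G_nonneg: "(s, t) \<in> Delta \<Longrightarrow> 0 \<le> G s t $ n"
  using a_pos[of s t] F_nonneg[of s t] by (simp add: G_nth)

lemma F_eq_G:
  assumes "(s, t) \<in> Delta"
  shows "F s t = fps_const (a s t) * fps_X * G s t"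
proof (rule fps_ext)
  fix n
  have "(fps_const (a s t) * fps_X * G s t) $ n = a s t * (fps_X * G s t) $ n"
    by (simp only: mult.assoc fps_mult_left_const_nth)
  then show "F s t $ n = (fps_const (a s t) * fps_X * G s t) $ n"
    using a_pos[OF assms] F_nth_0[OF assms] by (cases n) (auto simp: G_nth)
qed

lemma G_refl: "0 \<le> s \<Longrightarrow> G s s = 1"
  by (rule fps_ext) (simp add: G_nth F_refl)

text \<open>Inserting \<open>F = a X G\<close> into the flow equation produces the common factor
  \<open>a s u\<close> times \<open>X\<close>, which cancels.\<close>

lemma G_compose:
  assumes "0 \<le> s" "s \<le> t" "t \<le> u"
  shows "G s u = (G s t oo F t u) * G t u"
proof -
  have D: "(s, t) \<in> Delta" "(t, u) \<in> Delta" "(s, u) \<in> Delta"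
    using assms by (auto simp: Delta_iff)
  have "fps_const (a s u) * fps_X * G s u = F s t oo F t u"
    using F_eq_G[OF D(3)] F_compose[OF assms] by simp
  also have "\<dots> = fps_const (a s t) * F t u * (G s t oo F t u)"
    using F_nth_0[OF D(2)]
    by (subst F_eq_G[OF D(1)]) (simp add: fps_compose_mult_distrib fps_X_fps_compose_startby0)
  also have "\<dots> = fps_const (a s t) * (fps_const (a t u) * fps_X * G t u) * (G s t oo F t u)"
    by (subst (1) F_eq_G[OF D(2)]) (rule refl)
  also have "\<dots> = fps_const (a s t * a t u) * fps_X * ((G s t oo F t u) * G t u)"
    by (simp add: mult_ac flip: fps_const_mult)
  also have "a s t * a t u = a s u"
    using a_mult[OF assms] by simp
  finally show ?thesis
    using a_pos[OF D(3)] by simp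
qed

section \<open>Nonnegativity of the coefficients of the logarithmic derivative\<close>

lemma logderiv_compose:
  assumes "0 \<le> s" "s \<le> t" "t \<le> u"
  shows "fps_logderiv (G s u) = (fps_logderiv (G s t) oo F t u) * fps_deriv (F t u) + fps_logderiv (G t u)"
proof -
  have D: "(s, t) \<in> Delta" "(t, u) \<in> Delta"
    using assms by (auto simp: Delta_iff)
  show ?thesis
    using D F_nth_0[OF D(2)] unfolding G_compose[OF assms]
    by (simp add: fps_logderiv_mult fps_logderiv_compose)
qed

text \<open>Write \<open>D = G'/G\<close> and \<open>e = (1 - a) / a\<close>. The equation
  \<open>D G = G'\<close> expresses \<open>D $ n\<close> as a nonnegative term minus a sum of
  \<open>n\<close> products. In each product the factor from \<open>D\<close> is at most
  \<open>n e\<close> and the factor from \<open>G\<close> at most \<open>e\<close>, because all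
  coefficients of \<open>F\<close> beyond the linear one are at most \<open>1 - a\<close>.\<close>

lemma logderiv_nth_lower_bound:
  assumes st: "(s, t) \<in> Delta" and nonneg: "\<And>k. k < n \<Longrightarrow> 0 \<le> fps_logderiv (G s t) $ k"
  shows "- (real n ^ 2 * ((1 - a s t) / a s t) ^ 2) \<le> fps_logderiv (G s t) $ n"
proof -
  define e where "e = (1 - a s t) / a s t"
  define D where "D = fps_logderiv (G s t)"
  have e: "0 \<le> e"
    using a_pos[OF st] a_le_1[OF st] by (simp add: e_def)
  have Ge: "G s t $ k \<le> e" if "1 \<le> k" for k
    using a_plus_nth_le_1[OF st, of "Suc k"] that a_pos[OF st] by (simp add: G_nth e_def divide_right_mono)
  have "D * G s t = fps_deriv (G s t)"
    using st by (simp add: D_def fps_logderiv_def mult.assoc inverse_mult_eq_1)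
  then have "fps_deriv (G s t) $ k = (\<Sum>i=0..k. D $ i * G s t $ (k - i))" for k
    by (metis fps_mult_nth)
  then have rec: "real (Suc k) * G s t $ Suc k = D $ k + (\<Sum>i<k. D $ i * G s t $ (k - i))" for k
    using st by (simp add: atLeast0AtMost flip: lessThan_Suc_atMost)
  have D_le: "D $ k \<le> real n * e" if "k < n" for k
  proof -
    have "0 \<le> (\<Sum>i<k. D $ i * G s t $ (k - i))"
      using nonneg that G_nonneg[OF st] by (intro sum_nonneg mult_nonneg_nonneg) (auto simp: D_def)
    then have "D $ k \<le> real (Suc k) * G s t $ Suc k"
      using rec[of k] by linarith
    also have "\<dots> \<le> real n * e"
      using Ge[of "Suc k"] G_nonneg[OF st] that by (intro mult_mono) auto
    finally show ?thesis .
  qed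
  have "(\<Sum>i<n. D $ i * G s t $ (n - i)) \<le> (\<Sum>i<n. (real n * e) * e)"
    using D_le Ge G_nonneg[OF st] e by (intro sum_mono mult_mono) auto
  also have "\<dots> = real n ^ 2 * e ^ 2"
    by (simp add: power2_eq_square)
  finally have "real (Suc n) * G s t $ Suc n - real n ^ 2 * e ^ 2 \<le> D $ n"
    using rec[of n] by linarith
  moreover have "0 \<le> real (Suc n) * G s t $ Suc n"
    using G_nonneg[OF st] by (intro mult_nonneg_nonneg) auto
  ultimately show ?thesis
    unfolding D_def e_def by linarith
qed

text \<open>Only the coefficient of index \<open>n\<close> may be negative. In
  \<open>logderiv_compose\<close> it enters with the factor \<open>a t u ^ n\<close> from the
  composition and one more \<open>a t u\<close> from the derivative of \<open>F t u\<close>; all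
  other terms of the product are nonnegative and are dropped.\<close>

lemma logderiv_nth_chain:
  assumes "0 \<le> s" "s \<le> t" "t \<le> u" and nonneg: "\<And>k. k < n \<Longrightarrow> 0 \<le> fps_logderiv (G s t) $ k"
  shows "a t u ^ Suc n * fps_logderiv (G s t) $ n + fps_logderiv (G t u) $ n \<le> fps_logderiv (G s u) $ n"
proof -
  have tu: "(t, u) \<in> Delta"
    using assms by (auto simp: Delta_iff)
  define D where "D = fps_logderiv (G s t)"
  have pow: "F t u ^ k $ k = a t u ^ k" for k
    using startsby_zero_power_nth_same[OF F_nth_0[OF tu]] by (simp add: a_def)
  have comp: "0 \<le> (D oo F t u) $ k" if "k < n" for k
    unfolding fps_compose_nth using that nonneg F_nonneg[OF tu]
    by (intro sum_nonneg mult_nonneg_nonneg fps_power_nonneg) (auto simp: D_def)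
  have "0 \<le> (\<Sum>i<n. D $ i * (F t u ^ i $ n))"
    using nonneg F_nonneg[OF tu]
    by (intro sum_nonneg mult_nonneg_nonneg fps_power_nonneg) (auto simp: D_def)
  then have 1: "D $ n * a t u ^ n \<le> (D oo F t u) $ n"
    unfolding fps_compose_nth by (simp add: atLeast0AtMost pow flip: lessThan_Suc_atMost)
  have "0 \<le> (\<Sum>i<n. (D oo F t u) $ i * fps_deriv (F t u) $ (n - i))"
    using comp F_nonneg[OF tu] by (intro sum_nonneg mult_nonneg_nonneg) auto
  then have "(D oo F t u) $ n * a t u \<le> ((D oo F t u) * fps_deriv (F t u)) $ n"
    unfolding fps_mult_nth by (simp add: atLeast0AtMost a_def flip: lessThan_Suc_atMost)
  moreover have "D $ n * a t u ^ n * a t u \<le> (D oo F t u) $ n * a t u"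
    using 1 a_nonneg[OF tu] by (rule mult_right_mono)
  ultimately show ?thesis
    unfolding logderiv_compose[OF assms(1-3)] by (simp add: D_def mult_ac)
qed

lemma logderiv_nonneg:
  assumes "(S, T) \<in> Delta"
  shows "0 \<le> fps_logderiv (G S T) $ n"
  using assms
proof (induction n arbitrary: S T rule: less_induct)
  case (less n)
  define c where "c = - ln (a S T)"
  have c: "0 \<le> c"
    using a_pos[OF less.prems] a_le_1[OF less.prems] by (simp add: c_def)
  \<comment> \<open>The lower bound \<open>e * ln (a s t)\<close> is additive over adjacent
    intervals by \<open>a_mult\<close>, which suits \<open>interval_chain_induct\<close>; afterwards
    \<open>e\<close> tends to 0.\<close>
  have bound: "- (e * c) \<le> fps_logderiv (G S T) $ n" if e: "0 < e" for e
  proof -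
    \<comment> \<open>The bound \<open>1 / 2\<close> ensures \<open>1 / a \<le> 2\<close> on short
      intervals, and the other one \<open>4 n^2 h \<le> e\<close>. The summand 1 keeps the
      denominator positive for \<open>n = 0\<close>.\<close>
    define h where "h = min (1 / 2) (e / (4 * real n ^ 2 + 1))"
    have pos: "0 < 4 * real n ^ 2 + 1"
      by (intro add_nonneg_pos) auto
    have h: "0 < h" "h \<le> 1 / 2"
      using e pos by (simp_all add: h_def min_def)
    have "h \<le> e / (4 * real n ^ 2 + 1)"
      unfolding h_def by (rule min.cobounded2)
    then have "h * (4 * real n ^ 2 + 1) \<le> e"
      using pos by (simp add: pos_le_divide_eq)
    then have h': "4 * real n ^ 2 * h \<le> e"
      using h(1) by (simp add: algebra_simps)
    obtain d where d: "0 < d"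
      "\<And>s t. S \<le> s \<Longrightarrow> s \<le> t \<Longrightarrow> t \<le> T \<Longrightarrow> t - s < d \<Longrightarrow> 1 - h < a s t"
      using a_near_diagonal[of S h T] less.prems h by (auto simp: Delta_iff)
    have "e * ln (a S T) \<le> fps_logderiv (G S T) $ n"
    proof (rule interval_chain_induct[where d=d and S=S and T=T
          and P="\<lambda>s t. e * ln (a s t) \<le> fps_logderiv (G s t) $ n"])
      fix s t assume st: "S \<le> s" "s \<le> t" "t \<le> T" "t - s < d"
      then have D: "(s, t) \<in> Delta"
        using less.prems by (auto simp: Delta_iff)
      have a: "1 - h < a s t" "a s t \<le> 1" "0 < a s t"
        using d(2)[OF st] a_le_1[OF D] a_pos[OF D] by auto
      have "(1 - a s t) / a s t \<le> 2 * (1 - a s t)"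
      proof -
        have "1 * (1 - a s t) \<le> (2 * a s t) * (1 - a s t)"
          using a h by (intro mult_right_mono) auto
        then show ?thesis using a by (simp add: field_simps)
      qed
      then have "((1 - a s t) / a s t) ^ 2 \<le> (2 * (1 - a s t)) ^ 2"
        using a by (intro power_mono) auto
      then have "real n ^ 2 * ((1 - a s t) / a s t) ^ 2 \<le> real n ^ 2 * (2 * (1 - a s t)) ^ 2"
        by (intro mult_left_mono) auto
      also have "\<dots> = (4 * real n ^ 2 * (1 - a s t)) * (1 - a s t)"
        by (simp add: power2_eq_square algebra_simps)
      also have "\<dots> \<le> (4 * real n ^ 2 * h) * (1 - a s t)"
        using a by (intro mult_mono) auto
      also have "\<dots> \<le> e * (1 - a s t)"
        using h' a by (intro mult_right_mono) auto
      also have "\<dots> \<le> e * - ln (a s t)"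
        using ln_le_minus_one[OF a(3)] e by (intro mult_left_mono) auto
      finally show "e * ln (a s t) \<le> fps_logderiv (G s t) $ n"
        using logderiv_nth_lower_bound[OF D, of n] less.IH D by fastforce
    next
      fix s t u assume stu: "S \<le> s" "s \<le> t" "t \<le> u" "u \<le> T"
        and st: "e * ln (a s t) \<le> fps_logderiv (G s t) $ n"
        and tu: "e * ln (a t u) \<le> fps_logderiv (G t u) $ n"
      have D: "(s, t) \<in> Delta" "(t, u) \<in> Delta"
        using stu less.prems by (auto simp: Delta_iff)
      note pos = a_pos[OF D(1)] a_pos[OF D(2)]
      \<comment> \<open>This is the damping factor of \<open>logderiv_nth_chain\<close>. Since
        \<open>w \<le> 1\<close> and \<open>ln (a s t) \<le> 0\<close>, multiplication by
        \<open>w\<close> only raises the bound on the first interval.\<close>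
      define w where "w = a t u ^ Suc n"
      have w: "0 \<le> w" "w \<le> 1"
        unfolding w_def using a_nonneg[OF D(2)] a_le_1[OF D(2)] by (simp, intro power_le_one)
      have "a s u = a s t * a t u"
        using stu less.prems by (intro a_mult) (auto simp: Delta_iff)
      then have "e * ln (a s u) = e * ln (a s t) + e * ln (a t u)"
        using pos by (simp add: ln_mult algebra_simps)
      also have "e * ln (a s t) \<le> w * (e * ln (a s t))"
      proof -
        have "e * ln (a s t) \<le> 0"
          using e pos a_le_1[OF D(1)] by (simp add: mult_nonneg_nonpos)
        then show ?thesis
          using w mult_right_mono_neg[of w 1 "e * ln (a s t)"] by simp
      qed
      also have "\<dots> \<le> w * fps_logderiv (G s t) $ n"
        using st w by (intro mult_left_mono) auto
      finally have "e * ln (a s u) \<le> w * fps_logderiv (G s t) $ n + fps_logderiv (G t u) $ n"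
        using tu by simp
      also have "\<dots> \<le> fps_logderiv (G s u) $ n"
        unfolding w_def using stu less.prems less.IH[OF _ D(1)]
        by (intro logderiv_nth_chain) (auto simp: Delta_iff)
      finally show "e * ln (a s u) \<le> fps_logderiv (G s u) $ n" .
    qed (use d less.prems in \<open>auto simp: Delta_iff\<close>)
    then show ?thesis by (simp add: c_def)
  qed
  show ?case
  proof (rule field_le_epsilon)
    fix e :: real assume e: "0 < e"
    \<comment> \<open>Dividing by \<open>c + 1\<close> instead of \<open>c\<close> covers the case
      \<open>c = 0\<close>.\<close>
    have "- e \<le> - (e / (c + 1) * c)"
      using e c by (simp add: field_simps)
    also have "\<dots> \<le> fps_logderiv (G S T) $ n"
      using e c by (intro bound) auto
    finally show "0 \<le> fps_logderiv (G S T) $ n + e" by simp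
  qed
qed

end

section \<open>Real powers of the flow\<close>

context pgf_flow
begin

text \<open>The power \<open>F^x\<close> without its factor \<open>z^x\<close>, which is no power
  series for fractional \<open>x\<close>. The coefficients describe the increment of a population
  started from \<open>x\<close>.\<close>

definition R :: "real \<Rightarrow> real \<Rightarrow> real \<Rightarrow> real fps" where
  "R s t x = fps_const (a s t powr x) * fps_rpow (G s t) x"

lemma R_nth: "R s t x $ n = a s t powr x * fps_rpow (G s t) x $ n"
  by (simp add: R_def)

lemma R_nonneg: "(s, t) \<in> Delta \<Longrightarrow> 0 \<le> x \<Longrightarrow> 0 \<le> R s t x $ n"
  by (simp add: R_nth fps_rpow_nonneg logderiv_nonneg)

lemma R_refl: "0 \<le> s \<Longrightarrow> R s s x = 1"
  by (simp add: R_def G_refl fps_rpow_def)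

lemma R_add: "(s, t) \<in> Delta \<Longrightarrow> R s t (x + y) = R s t x * R s t y"
  by (simp add: R_def fps_rpow_add powr_add mult_ac flip: fps_const_mult)

lemma X_power_R_of_nat:
  assumes "(s, t) \<in> Delta"
  shows "fps_X ^ m * R s t (real m) = F s t ^ m"
proof -
  have "F s t ^ m = fps_const (a s t) ^ m * fps_X ^ m * G s t ^ m"
    by (subst F_eq_G[OF assms]) (simp add: power_mult_distrib)
  then show ?thesis
    using assms a_pos[OF assms]
    by (simp add: R_def fps_rpow_of_nat powr_realpow fps_const_power mult_ac)
qed

lemma R_of_nat_nth:
  assumes "(s, t) \<in> Delta"
  shows "R s t (real m) $ n = (F s t ^ m) $ (n + m)"
  using X_power_R_of_nat[OF assms, of m, symmetric] by (simp add: fps_X_power_mult_nth)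

lemma R_sum_le_1_of_nat:
  assumes st: "(s, t) \<in> Delta"
  shows "(\<Sum>n\<le>N. R s t (real m) $ n) \<le> 1"
proof -
  have "(\<Sum>n\<le>N. R s t (real m) $ n) = (\<Sum>n\<in>{m..N + m}. (F s t ^ m) $ n)"
    using sum.shift_bounds_cl_nat_ivl[of "\<lambda>n. (F s t ^ m) $ n" 0 m N]
    by (simp add: R_of_nat_nth[OF st] atLeast0AtMost)
  also have "\<dots> \<le> (\<Sum>n\<le>N + m. (F s t ^ m) $ n)"
    using F_nonneg[OF st] by (intro sum_mono2 fps_power_nonneg) auto
  also have "\<dots> \<le> 1"
    using F_nonneg[OF st] F_sum_le_1[OF st] by (rule fps_power_partial_sum_le_1)
  finally show ?thesis .
qed

text \<open>Round \<open>x\<close> up to an integer \<open>m\<close> and let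
  \<open>y = m - x\<close>. The constant coefficient of \<open>R s t y\<close> is
  \<open>a^y\<close>, hence at least \<open>a\<close>, while the coefficients of the product
  \<open>R s t m\<close> sum to at most 1.\<close>

lemma R_sum_bounded:
  assumes st: "(s, t) \<in> Delta" and x: "0 \<le> x"
  shows "(\<Sum>n\<le>N. R s t x $ n) \<le> 1 / a s t"
proof -
  define m where "m = nat \<lceil>x\<rceil>"
  define y where "y = real m - x"
  have y: "0 \<le> y" "y \<le> 1"
    using x by (simp_all add: m_def y_def) linarith+
  have "a s t = a s t powr 1"
    using a_pos[OF st] by simp
  also have "\<dots> \<le> a s t powr y"
    using y a_pos[OF st] a_le_1[OF st] by (intro powr_mono') auto
  also have "\<dots> = (\<Sum>n\<le>0. R s t y $ n)"
    by (simp add: R_nth)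
  finally have "(\<Sum>n\<le>N. R s t x $ n) * a s t \<le> (\<Sum>n\<le>N. R s t x $ n) * (\<Sum>n\<le>0. R s t y $ n)"
    using R_nonneg[OF st x] by (intro mult_left_mono sum_nonneg) auto
  also have "\<dots> \<le> (\<Sum>n\<le>N + 0. (R s t x * R s t y) $ n)"
    using R_nonneg[OF st] x y by (intro fps_mult_partial_sum_ge) auto
  also have "R s t x * R s t y = R s t (real m)"
    using R_add[OF st, of x y] by (simp add: y_def)
  also have "(\<Sum>n\<le>N + 0. R s t (real m) $ n) \<le> 1"
    using R_sum_le_1_of_nat[OF st, of m N] by simp
  finally show ?thesis
    using a_pos[OF st] by (simp add: pos_le_divide_eq)
qed

text \<open>The bound \<open>1 / a\<close> does not depend on \<open>x\<close>, so the semigroup property in \<open>x\<close>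
  improves it to 1.\<close>

lemma R_sum_le_1:
  assumes st: "(s, t) \<in> Delta" and x: "0 \<le> x"
  shows "(\<Sum>n\<le>N. R s t x $ n) \<le> 1"
proof (rule ccontr)
  define b where "b = (\<Sum>n\<le>N. R s t x $ n)"
  assume "\<not> ?thesis"
  then have b: "1 < b"
    by (simp add: b_def)
  have pow: "b ^ m \<le> (\<Sum>n\<le>m * N. R s t (real m * x) $ n)" for m
  proof (induction m)
    case 0
    then show ?case by (simp add: R_def fps_rpow_def a_pos[OF st, THEN less_imp_neq, symmetric])
  next
    case (Suc m)
    have "b ^ Suc m \<le> b * (\<Sum>n\<le>m * N. R s t (real m * x) $ n)"
      using Suc b by simp
    also have "\<dots> \<le> (\<Sum>n\<le>N + m * N. (R s t x * R s t (real m * x)) $ n)"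
      unfolding b_def using R_nonneg[OF st] x by (intro fps_mult_partial_sum_ge) auto
    also have "R s t x * R s t (real m * x) = R s t (real (Suc m) * x)"
      using R_add[OF st, of x "real m * x"] by (simp add: algebra_simps)
    finally show ?case by (simp add: algebra_simps)
  qed
  obtain m where "1 / a s t < b ^ m"
    using b real_arch_pow by blast
  then show False
    using pow[of m] R_sum_bounded[OF st, of "real m * x" "m * N"] x by simp
qed

text \<open>Chapman-Kolmogorov equation for increments: after \<open>i\<close> newcomers the second
  stage starts from \<open>x + i\<close>. Algebraically, \<open>F^i\<close> is absorbed into
  \<open>R t u x\<close>, giving \<open>X^i\<close> times \<open>R t u (x + i)\<close>.\<close>

lemma R_compose:
  assumes "0 \<le> s" "s \<le> t" "t \<le> u"
  shows "R s u x $ n = (\<Sum>i=0..n. R s t x $ i * R t u (x + real i) $ (n - i))"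
proof -
  have D: "(s, t) \<in> Delta" "(t, u) \<in> Delta"
    using assms by (auto simp: Delta_iff)
  note F0 = F_nth_0[OF D(2)]
  have "fps_rpow (G s u) x = fps_rpow (G t u) x * (fps_rpow (G s t) x oo F t u)"
    using D F0 unfolding G_compose[OF assms] by (simp add: fps_rpow_mult fps_rpow_compose)
  moreover have "a s u powr x = a s t powr x * a t u powr x"
    using a_mult[OF assms] a_nonneg[OF D(1)] a_nonneg[OF D(2)] by (simp add: powr_mult)
  ultimately have "R s u x = R t u x * (R s t x oo F t u)"
    using F0 by (simp add: R_def fps_compose_mult_distrib mult_ac flip: fps_const_mult)
  then have "R s u x $ n = (\<Sum>i=0..n. R s t x $ i * (R t u x * F t u ^ i) $ n)"
    using fps_mult_compose_nth[OF F0] by simp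
  also have "\<dots> = (\<Sum>i=0..n. R s t x $ i * R t u (x + real i) $ (n - i))"
  proof (intro sum.cong refl arg_cong2[where f="(*)"])
    fix i assume "i \<in> {0..n}"
    moreover have "R t u x * F t u ^ i = fps_X ^ i * R t u (x + real i)"
      by (simp add: R_add[OF D(2)] mult_ac flip: X_power_R_of_nat[OF D(2)])
    ultimately show "(R t u x * F t u ^ i) $ n = R t u (x + real i) $ (n - i)"
      by (simp add: fps_X_power_mult_nth)
  qed
  finally show ?thesis .
qed

text \<open>A coefficient is a power of \<open>a\<close> times a finite sum of binomials in
  \<open>x\<close> and coefficients of powers of \<open>G - 1\<close>. All of these are continuous
  because \<open>a\<close> does not vanish.\<close>

lemma R_continuous:
  "continuous_on {(s, t, x). (s, t) \<in> Delta} (\<lambda>(s, t, x). R s t x $ n)"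
proof -
  let ?S = "{(s, t, x :: real). (s, t) \<in> Delta}"
  have F: "continuous_on ?S (\<lambda>z. F (fst z) (fst (snd z)) $ k)" for k
  proof -
    have "continuous_on ?S ((\<lambda>(s, t). F s t $ k) \<circ> (\<lambda>z. (fst z, fst (snd z))))"
      by (intro continuous_on_compose continuous_intros continuous_on_subset[OF F_cont]) auto
    then show ?thesis by (simp add: o_def)
  qed
  have a: "continuous_on ?S (\<lambda>z. a (fst z) (fst (snd z)))"
    unfolding a_def by (rule F)
  have a0: "\<forall>z\<in>?S. a (fst z) (fst (snd z)) \<noteq> 0"
    using a_pos by fastforce
  have "continuous_on ?S (\<lambda>z. (G (fst z) (fst (snd z)) - 1) $ k)" for k
    using a0 by (auto simp: G_nth intro!: continuous_intros F a)
  note power = continuous_on_fps_power_nth[OF this]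
  have "continuous_on ?S (\<lambda>z. R (fst z) (fst (snd z)) (snd (snd z)) $ n)"
    unfolding R_nth fps_rpow_nth gbinomial_prod_rev
    using a0 by (intro continuous_intros a power) auto
  then show ?thesis
    by (simp add: case_prod_unfold)
qed

end

section \<open>Laws on the extended naturals\<close>

lemma nn_integral_count_space_enat:
  fixes g :: "enat \<Rightarrow> ennreal"
  shows "(\<integral>\<^sup>+ i. g i \<partial>count_space UNIV) = (\<Sum>n. g (enat n)) + g \<infinity>"
proof -
  have split: "g i = g i * indicator (range enat) i + g i * indicator {\<infinity>} i" for i
    by (cases i) (auto simp: indicator_def)
  have "(\<integral>\<^sup>+ i. g i \<partial>count_space UNIV)
      = (\<integral>\<^sup>+ i. g i * indicator (range enat) i \<partial>count_space UNIV)
      + (\<integral>\<^sup>+ i. g i * indicator {\<infinity>} i \<partial>count_space UNIV)"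
    by (subst split) (rule nn_integral_add, auto)
  also have "(\<integral>\<^sup>+ i. g i * indicator (range enat) i \<partial>count_space UNIV)
      = (\<integral>\<^sup>+ i. g i \<partial>count_space (range enat))"
    by (simp add: nn_integral_count_space_indicator)
  also have "\<dots> = (\<integral>\<^sup>+ n. g (enat n) \<partial>count_space UNIV)"
    by (rule nn_integral_bij_count_space[symmetric]) (auto simp: bij_betw_def inj_on_def)
  also have "\<dots> = (\<Sum>n. g (enat n))"
    by (rule nn_integral_count_space_nat)
  finally show ?thesis by simp
qed

lemma pmf_enat_infinity:
  "ennreal (pmf p \<infinity>) = 1 - (\<Sum>n. ennreal (pmf p (enat n)))"
proof -
  have "1 = (\<integral>\<^sup>+ i. ennreal (pmf p i) \<partial>count_space UNIV)"
    by (simp add: nn_integral_pmf measure_pmf.emeasure_space_1[simplified])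
  also have "\<dots> = (\<Sum>n. ennreal (pmf p (enat n))) + ennreal (pmf p \<infinity>)"
    by (rule nn_integral_count_space_enat)
  finally have eq: "1 = (\<Sum>n. ennreal (pmf p (enat n))) + ennreal (pmf p \<infinity>)" .
  then have fin: "(\<Sum>n. ennreal (pmf p (enat n))) \<noteq> top"
    by (metis ennreal_add_eq_top ennreal_one_neq_top)
  have "1 - (\<Sum>n. ennreal (pmf p (enat n)))
      = (\<Sum>n. ennreal (pmf p (enat n))) + ennreal (pmf p \<infinity>) - (\<Sum>n. ennreal (pmf p (enat n)))"
    using eq by (rule arg_cong)
  also have "\<dots> = ennreal (pmf p \<infinity>)"
    using fin by (rule ennreal_add_diff_cancel_left)
  finally show ?thesis by (rule sym)
qed

text \<open>The mass at infinity is the defect of the finite masses, so comparing coefficients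
  suffices.\<close>

lemma enat_pmf_eqI:
  assumes "\<And>n. pmf p (enat n) = pmf q (enat n)"
  shows "p = q"
proof (rule pmf_eqI)
  fix i :: enat
  have "ennreal (pmf p \<infinity>) = ennreal (pmf q \<infinity>)"
    by (simp add: pmf_enat_infinity assms)
  then show "pmf p i = pmf q i"
    using assms by (cases i) simp_all
qed

lemma nn_integral_enat_pmf:
  "(\<integral>\<^sup>+ i. g i \<partial>measure_pmf p) = (\<Sum>n. ennreal (pmf p (enat n)) * g (enat n))
     + (1 - (\<Sum>n. ennreal (pmf p (enat n)))) * g \<infinity>"
  by (simp add: nn_integral_measure_pmf nn_integral_count_space_enat pmf_enat_infinity)

text \<open>The missing mass of a subprobability sequence, held at \<open>None\<close> by
  \<open>embed_spmf\<close>, is placed at infinity.\<close>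

definition enat_pmf_of :: "(nat \<Rightarrow> real) \<Rightarrow> enat pmf" where
  "enat_pmf_of f = map_pmf (case_option \<infinity> enat) (embed_spmf f)"

lemma pmf_enat_pmf_of:
  assumes nonneg: "\<And>n. 0 \<le> f n" and sum: "\<And>N. (\<Sum>n\<le>N. f n) \<le> 1"
  shows "pmf (enat_pmf_of f) (enat n) = f n"
proof -
  have "(\<Sum>n<N. ennreal (f n)) \<le> 1" for N
  proof -
    have "(\<Sum>n<N. f n) \<le> (\<Sum>n\<le>N. f n)"
      using nonneg by (intro sum_mono2) auto
    then show ?thesis
      using sum[of N] nonneg by simp
  qed
  then have le: "(\<integral>\<^sup>+ n. ennreal (f n) \<partial>count_space UNIV) \<le> 1"
    by (simp add: nn_integral_count_space_nat suminf_eq_SUP SUP_least)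
  have "(case_option \<infinity> enat) -` {enat n} = {Some n}"
    by (auto split: option.splits)
  then show ?thesis
    using spmf_embed_spmf[OF le, of n] nonneg[of n]
    by (simp add: enat_pmf_of_def pmf_map measure_pmf_single)
qed

lemma pmf_conv_pmf:
  "pmf (conv_pmf p q) (enat n) = (\<Sum>i=0..n. pmf p (enat i) * pmf q (enat (n - i)))"
proof -
  have "(\<lambda>(a, b). a + b) -` {enat n} = (\<lambda>i. (enat i, enat (n - i))) ` {0..n}"
  proof (intro set_eqI iffI)
    fix z assume "z \<in> (\<lambda>(a, b). a + b) -` {enat n}"
    then obtain i j where "z = (enat i, enat j)" "i + j = n"
      by (cases z, cases "fst z"; cases "snd z") auto
    then show "z \<in> (\<lambda>i. (enat i, enat (n - i))) ` {0..n}"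
      by (auto intro!: image_eqI[where x=i])
  qed auto
  then have "pmf (conv_pmf p q) (enat n)
      = (\<Sum>z\<in>(\<lambda>i. (enat i, enat (n - i))) ` {0..n}. pmf (pair_pmf p q) z)"
    by (simp add: conv_pmf_def pmf_map measure_measure_pmf_finite)
  also have "\<dots> = (\<Sum>i=0..n. pmf p (enat i) * pmf q (enat (n - i)))"
    by (subst sum.reindex) (auto simp: inj_on_def pmf_pair)
  finally show ?thesis .
qed

text \<open>A kernel that cannot reach \<open>n\<close> from above leaves only finitely many
  intermediate states.\<close>

lemma pmf_bind_enat:
  assumes "pmf (K \<infinity>) (enat n) = 0" "\<And>i. n < i \<Longrightarrow> pmf (K (enat i)) (enat n) = 0"
  shows "pmf (bind_pmf p K) (enat n) = (\<Sum>i=0..n. pmf p (enat i) * pmf (K (enat i)) (enat n))"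
proof -
  have "pmf (bind_pmf p K) (enat n) = (\<Sum>i\<in>enat ` {0..n}. pmf (K i) (enat n) * pmf p i)"
    unfolding pmf_bind
  proof (rule integral_measure_pmf_real)
    fix i assume i: "pmf (K i) (enat n) \<noteq> 0"
    then obtain j where "i = enat j"
      using assms(1) by (cases i) auto
    moreover have "j \<le> n"
      using i assms(2)[of j] calculation by (cases "n < j") auto
    ultimately show "i \<in> enat ` {0..n}"
      by simp
  qed simp
  also have "\<dots> = (\<Sum>i=0..n. pmf p (enat i) * pmf (K (enat i)) (enat n))"
    by (subst sum.reindex) (auto simp: inj_on_def mult.commute)
  finally show ?thesis .
qed

lemma pmf_map_plus_enat:
  "pmf (map_pmf ((+) (enat m)) p) (enat n) = (if m \<le> n then pmf p (enat (n - m)) else 0)"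
proof -
  have "(+) (enat m) -` {enat n} = (if m \<le> n then {enat (n - m)} else {})"
  proof (intro set_eqI)
    fix i show "i \<in> (+) (enat m) -` {enat n} \<longleftrightarrow> i \<in> (if m \<le> n then {enat (n - m)} else {})"
      by (cases i) auto
  qed
  then show ?thesis
    by (simp add: pmf_map measure_pmf_single)
qed

lemma sum_pmf_enat_le_1: "(\<Sum>n\<le>N. pmf p (enat n)) \<le> 1"
proof -
  have "(\<Sum>n\<le>N. pmf p (enat n)) = measure (measure_pmf p) (enat ` {..N})"
    by (simp add: measure_measure_pmf_finite sum.reindex inj_on_def)
  then show ?thesis by simp
qed

text \<open>Finite points are isolated in \<open>enat\<close>. Hence weak continuity yields
  continuity of each single coefficient.\<close>

lemma continuous_on_indicator_enat:
  "continuous_on UNIV (indicator {enat n} :: enat \<Rightarrow> real)"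
proof (subst continuous_on_open_vimage[OF open_UNIV], intro allI impI)
  fix B :: "real set"
  have "indicator {enat n} -` B = (if 1 \<in> B then {enat n} else {}) \<union> (if 0 \<in> B then - {enat n} else {})"
    by (rule set_eqI) (simp add: indicator_def)
  moreover have "open (- {enat n})"
    by (rule open_Compl) simp
  ultimately show "open (indicator {enat n} -` B \<inter> (UNIV :: enat set))"
    using open_enat[of n] by auto
qed

lemma pgf_0_eq: "pgf p 0 = pmf p 0"
proof -
  have "(\<Sum>n. pmf p (enat n) * 0 ^ n) = (\<Sum>n\<in>{0}. pmf p (enat n) * 0 ^ n)"
    by (rule suminf_finite) auto
  then show ?thesis by (simp add: pgf_def zero_enat_def)
qed

section \<open>From branching kernels to generating functions\<close>

definition offspring_fps :: "(real \<Rightarrow> real \<Rightarrow> enat \<Rightarrow> enat pmf) \<Rightarrow> real \<Rightarrow> real \<Rightarrow> real fps" where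
  "offspring_fps l s t = Abs_fps (\<lambda>n. pmf (l s t 1) (enat n))"

context
  fixes l assumes l: "branching_kernels_enat l"
begin

lemma kernel_refl: "0 \<le> s \<Longrightarrow> l s s n = return_pmf n"
  and kernel_bind: "0 \<le> s \<Longrightarrow> s \<le> t \<Longrightarrow> t \<le> u \<Longrightarrow> l s u n = bind_pmf (l s t n) (l t u)"
  and kernel_conv: "(s, t) \<in> Delta \<Longrightarrow> l s t (enat (i + j)) = conv_pmf (l s t (enat i)) (l s t (enat j))"
  and kernel_0: "(s, t) \<in> Delta \<Longrightarrow> l s t 0 = return_pmf 0"
  and kernel_infinity: "(s, t) \<in> Delta \<Longrightarrow> l s t \<infinity> = return_pmf \<infinity>"
  using l unfolding branching_kernels_enat_def by simp_all

lemma pmf_kernel_continuous: "continuous_on Delta (\<lambda>(s, t). pmf (l s t (enat m)) (enat n))"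
proof -
  have "continuous_on Delta (\<lambda>(s, t). measure_pmf.expectation (l s t (enat m)) (indicator {enat n} :: enat \<Rightarrow> real))"
    using l continuous_on_indicator_enat unfolding branching_kernels_enat_def by blast
  then show ?thesis
    by (simp add: measure_pmf_single)
qed

lemma pmf_kernel_eq_power:
  assumes "(s, t) \<in> Delta"
  shows "pmf (l s t (enat m)) (enat n) = (offspring_fps l s t ^ m) $ n"
proof (induction m arbitrary: n)
  case 0
  then show ?case
    using kernel_0[OF assms] by (auto simp: zero_enat_def indicator_def)
next
  case (Suc m)
  show ?case
    using kernel_conv[OF assms, of 1 m]
    by (simp add: pmf_conv_pmf fps_mult_nth Suc) (simp add: offspring_fps_def one_enat_def)
qed

text \<open>Without death the offspring series has no constant term, so its \<open>m\<close>-th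
  power starts in degree \<open>m\<close>.\<close>

lemma pmf_kernel_eq_0_of_less:
  assumes "(s, t) \<in> Delta" "pgf (l s t 1) 0 = 0" "n < m"
  shows "pmf (l s t (enat m)) (enat n) = 0"
  using assms
  by (simp add: pmf_kernel_eq_power startsby_zero_power_prefix offspring_fps_def pgf_0_eq zero_enat_def)

text \<open>The flow equation is the Chapman-Kolmogorov equation for one individual; its sum over
  intermediate states is finite because populations do not decrease.\<close>

lemma pgf_flow_offspring:
  assumes no_death: "\<And>s t. (s, t) \<in> Delta \<Longrightarrow> pgf (l s t 1) 0 = 0"
  shows "pgf_flow (offspring_fps l)"
proof
  show 0: "offspring_fps l s t $ 0 = 0" if "(s, t) \<in> Delta" for s t
    using no_death[OF that] by (simp add: offspring_fps_def pgf_0_eq zero_enat_def)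
  show "0 \<le> offspring_fps l s t $ n" "(\<Sum>n\<le>N. offspring_fps l s t $ n) \<le> 1" for s t n N
    by (simp_all add: offspring_fps_def sum_pmf_enat_le_1)
  show "offspring_fps l s s = fps_X" if "0 \<le> s" for s
    using kernel_refl[OF that] by (auto simp: offspring_fps_def fps_eq_iff one_enat_def indicator_def)
  show "continuous_on Delta (\<lambda>(s, t). offspring_fps l s t $ n)" for n
    using pmf_kernel_continuous[of 1 n] by (simp add: offspring_fps_def one_enat_def)
  fix s t u :: real assume stu: "0 \<le> s" "s \<le> t" "t \<le> u"
  then have D: "(s, t) \<in> Delta" "(t, u) \<in> Delta"
    by (auto simp: Delta_iff)
  show "offspring_fps l s u = offspring_fps l s t oo offspring_fps l t u"
  proof (rule fps_ext)
    fix n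
    have "pmf (l s u 1) (enat n) = (\<Sum>i=0..n. pmf (l s t 1) (enat i) * pmf (l t u (enat i)) (enat n))"
      unfolding kernel_bind[OF stu]
      using D no_death by (intro pmf_bind_enat) (auto simp: kernel_infinity pmf_kernel_eq_0_of_less)
    then show "offspring_fps l s u $ n = (offspring_fps l s t oo offspring_fps l t u) $ n"
      using D by (simp add: fps_compose_nth pmf_kernel_eq_power) (simp add: offspring_fps_def)
  qed
qed

end

section \<open>The embedding kernels\<close>

lemma emeasure_conv_meas:
  assumes "prob_space M" "prob_space M'" and sets: "sets M = sets borel" "sets M' = sets borel"
    and B: "B \<in> sets borel"
  shows "emeasure (conv_meas M M') B = (\<integral>\<^sup>+ x. \<integral>\<^sup>+ y. indicator B (x + y) \<partial>M' \<partial>M)"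
proof -
  interpret M: prob_space M by fact
  interpret M': prob_space M' by fact
  interpret pair_prob_space M M' ..
  note [measurable_cong] = sets
  note [measurable] = B
  have "(\<lambda>(a, b). a + b) \<in> measurable (M \<Otimes>\<^sub>M M') (borel :: ennreal measure)"
    by measurable
  then have "emeasure (conv_meas M M') B
      = emeasure (M \<Otimes>\<^sub>M M') ((\<lambda>(a, b). a + b) -` B \<inter> space (M \<Otimes>\<^sub>M M'))"
    unfolding conv_meas_def using B by (rule emeasure_distr)
  also have "\<dots> = (\<integral>\<^sup>+ x. \<integral>\<^sup>+ y. indicator ((\<lambda>(a, b). a + b) -` B \<inter> space (M \<Otimes>\<^sub>M M')) (x, y) \<partial>M' \<partial>M)"
    by (rule M'.emeasure_pair_measure) measurable
  also have "\<dots> = (\<integral>\<^sup>+ x. \<integral>\<^sup>+ y. indicator B (x + y) \<partial>M' \<partial>M)"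
    by (intro nn_integral_cong) (auto simp: indicator_def space_pair_measure)
  finally show ?thesis .
qed

lemma enn2real_of_nat: "enn2real (of_nat n) = real n"
  by (metis enn2real_ennreal ennreal_of_nat_eq_real_of_nat of_nat_0_le_iff)

locale immortal_branching =
  fixes l :: "real \<Rightarrow> real \<Rightarrow> enat \<Rightarrow> enat pmf"
  assumes kernels: "branching_kernels_enat l"
    and no_death: "\<And>s t. (s, t) \<in> Delta \<Longrightarrow> pgf (l s t 1) 0 = 0"

sublocale immortal_branching \<subseteq> pgf_flow "offspring_fps l"
  using kernels no_death by (rule pgf_flow_offspring)

context immortal_branching
begin

text \<open>The law of the increment of a population started from \<open>x\<close>, with explosion
  as the value infinity.\<close>

definition q :: "real \<Rightarrow> real \<Rightarrow> real \<Rightarrow> enat pmf" where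
  "q s t x = enat_pmf_of (\<lambda>n. R s t x $ n)"

lemma pmf_q: "(s, t) \<in> Delta \<Longrightarrow> 0 \<le> x \<Longrightarrow> pmf (q s t x) (enat n) = R s t x $ n"
  unfolding q_def by (intro pmf_enat_pmf_of R_nonneg R_sum_le_1)

lemma q_refl: "0 \<le> s \<Longrightarrow> 0 \<le> x \<Longrightarrow> q s s x = return_pmf 0"
  by (rule enat_pmf_eqI) (simp add: pmf_q Delta_iff R_refl zero_enat_def indicator_def)

lemma q_add:
  assumes "(s, t) \<in> Delta" "0 \<le> x" "0 \<le> y"
  shows "conv_pmf (q s t x) (q s t y) = q s t (x + y)"
  by (rule enat_pmf_eqI) (use assms in \<open>simp add: pmf_conv_pmf pmf_q R_add fps_mult_nth\<close>)

lemma kernel_eq_map_q: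
  assumes "(s, t) \<in> Delta"
  shows "l s t (enat m) = map_pmf ((+) (enat m)) (q s t (real m))"
proof (rule enat_pmf_eqI)
  fix n
  show "pmf (l s t (enat m)) (enat n) = pmf (map_pmf ((+) (enat m)) (q s t (real m))) (enat n)"
    using assms pmf_kernel_eq_0_of_less[OF kernels assms no_death[OF assms], of n m]
    by (auto simp: pmf_map_plus_enat pmf_q R_of_nat_nth pmf_kernel_eq_power[OF kernels])
qed

text \<open>The coefficient identity \<open>R_compose\<close> read as a statement about laws;
  infinity is absorbing.\<close>

lemma q_compose:
  assumes stu: "0 \<le> s" "s \<le> t" "t \<le> u" and x: "0 \<le> x"
  shows "q s u x = bind_pmf (q s t x)
    (\<lambda>i. case i of enat j \<Rightarrow> map_pmf ((+) i) (q t u (x + real j)) | \<infinity> \<Rightarrow> return_pmf \<infinity>)"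
proof (rule enat_pmf_eqI)
  fix n
  have D: "(s, t) \<in> Delta" "(t, u) \<in> Delta" "(s, u) \<in> Delta"
    using stu by (auto simp: Delta_iff)
  show "pmf (q s u x) (enat n) = pmf (bind_pmf (q s t x)
    (\<lambda>i. case i of enat j \<Rightarrow> map_pmf ((+) i) (q t u (x + real j)) | \<infinity> \<Rightarrow> return_pmf \<infinity>)) (enat n)"
    by (subst pmf_bind_enat) (use D x in \<open>auto simp: pmf_map_plus_enat pmf_q R_compose[OF stu]\<close>)
qed

text \<open>From a finite \<open>x\<close> the population stays on \<open>x\<close> plus the
  extended naturals. Infinity is treated apart because \<open>enn2real\<close> maps it to 0.\<close>

definition k :: "real \<Rightarrow> real \<Rightarrow> ennreal \<Rightarrow> ennreal measure" where
  "k s t x = (if x = \<infinity> then return borel \<infinity>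
     else distr (measure_pmf (q s t (enn2real x))) borel (\<lambda>n. x + ennreal_of_enat n))"

lemma k_top [simp]: "k s t top = return borel top"
  by (simp add: k_def)

lemma sets_k [simp, measurable_cong]: "sets (k s t x) = sets borel"
  by (simp add: k_def)

lemma prob_space_k: "prob_space (k s t x)"
  by (auto simp: k_def intro!: prob_space_return measure_pmf.prob_space_distr)

lemma emeasure_k:
  assumes "x \<noteq> \<infinity>" "B \<in> sets borel"
  shows "emeasure (k s t x) B = emeasure (measure_pmf (q s t (enn2real x))) {n. x + ennreal_of_enat n \<in> B}"
  using assms by (auto simp: k_def emeasure_distr vimage_def)

lemma nn_integral_k:
  assumes "x \<noteq> \<infinity>" "f \<in> borel_measurable borel"
  shows "(\<integral>\<^sup>+ y. f y \<partial>k s t x) = (\<integral>\<^sup>+ n. f (x + ennreal_of_enat n) \<partial>measure_pmf (q s t (enn2real x)))"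
  using assms by (simp add: k_def nn_integral_distr)

lemma k_measurable:
  assumes st: "(s, t) \<in> Delta" and B [measurable]: "B \<in> sets borel"
  shows "(\<lambda>x. emeasure (k s t x) B) \<in> borel_measurable borel"
proof -
  have [measurable]: "(\<lambda>x. R s t x $ n) \<in> borel_measurable borel" for n
  proof (rule borel_measurable_continuous_onI)
    have "continuous_on UNIV ((\<lambda>(s, t, x). R s t x $ n) \<circ> (\<lambda>x. (s, t, x)))"
      by (intro continuous_on_compose continuous_on_subset[OF R_continuous] continuous_intros)
         (use st in auto)
    then show "continuous_on UNIV (\<lambda>x. R s t x $ n)"
      by (simp add: o_def)
  qed
  \<comment> \<open>Written as a series over the increments, with the defect at infinity, the kernel
    is visibly measurable in \<open>x\<close>.\<close>
  have "emeasure (k s t x) B = (if x = \<infinity> then indicator B \<infinity> else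
      (\<Sum>n. ennreal (R s t (enn2real x) $ n) * indicator B (x + of_nat n))
      + (1 - (\<Sum>n. ennreal (R s t (enn2real x) $ n))) * indicator B \<infinity>)" for x
  proof (cases "x = \<infinity>")
    case False
    have "emeasure (k s t x) B = (\<integral>\<^sup>+ n. indicator {n. x + ennreal_of_enat n \<in> B} n \<partial>measure_pmf (q s t (enn2real x)))"
      using False B by (simp add: emeasure_k)
    also have "\<dots> = (\<integral>\<^sup>+ n. indicator B (x + ennreal_of_enat n) \<partial>measure_pmf (q s t (enn2real x)))"
      by (intro nn_integral_cong) (simp add: indicator_def)
    finally show ?thesis
      using False st by (simp add: nn_integral_enat_pmf pmf_q)
  qed (simp add: B)
  then show ?thesis by simp
qed

lemma k_refl:
  assumes "0 \<le> s"
  shows "k s s x = return borel x"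
proof (rule measure_eqI)
  fix B assume "B \<in> sets (k s s x)"
  then show "emeasure (k s s x) B = emeasure (return borel x) B"
    using assms by (cases "x = \<infinity>") (simp_all add: emeasure_k q_refl indicator_def)
qed simp

lemma k_Chapman_Kolmogorov:
  assumes stu: "0 \<le> s" "s \<le> t" "t \<le> u" and B: "B \<in> sets borel"
  shows "(\<integral>\<^sup>+ y. emeasure (k t u y) B \<partial>k s t x) = emeasure (k s u x) B"
proof -
  have meas: "(\<lambda>y. emeasure (k t u y) B) \<in> borel_measurable borel"
    using stu B by (intro k_measurable) (auto simp: Delta_iff)
  show ?thesis
  proof (cases "x = \<infinity>")
    case True
    then show ?thesis using meas by (simp add: nn_integral_return)
  next
    case False
    have "emeasure (k s u x) B = (\<integral>\<^sup>+ i. emeasure (measure_pmf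
        (case i of enat j \<Rightarrow> map_pmf ((+) i) (q t u (enn2real x + real j)) | \<infinity> \<Rightarrow> return_pmf \<infinity>))
        {n. x + ennreal_of_enat n \<in> B} \<partial>measure_pmf (q s t (enn2real x)))"
      using False B by (simp add: emeasure_k q_compose[OF stu])
    also have "\<dots> = (\<integral>\<^sup>+ i. emeasure (k t u (x + ennreal_of_enat i)) B \<partial>measure_pmf (q s t (enn2real x)))"
    proof (intro nn_integral_cong)
      fix i :: enat
      show "emeasure (measure_pmf
          (case i of enat j \<Rightarrow> map_pmf ((+) i) (q t u (enn2real x + real j)) | \<infinity> \<Rightarrow> return_pmf \<infinity>))
          {n. x + ennreal_of_enat n \<in> B} = emeasure (k t u (x + ennreal_of_enat i)) B"
      proof (cases i)
        case (enat j)
        have "enn2real (x + of_nat j) = enn2real x + real j"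
          using False
          by (subst enn2real_plus) (simp_all add: less_top ennreal_of_nat_eq_real_of_nat)
        then show ?thesis
          using False enat B by (simp add: emeasure_k vimage_def ennreal_of_enat_plus add.assoc)
      qed (simp add: B indicator_def)
    qed
    also have "\<dots> = (\<integral>\<^sup>+ y. emeasure (k t u y) B \<partial>k s t x)"
      using False meas by (simp add: nn_integral_k)
    finally show ?thesis ..
  qed
qed

lemma k_conv:
  assumes st: "(s, t) \<in> Delta" and x: "x \<noteq> \<infinity>" and y: "y \<noteq> \<infinity>"
  shows "conv_meas (k s t x) (k s t y) = k s t (x + y)"
proof (rule measure_eqI)
  fix B assume "B \<in> sets (conv_meas (k s t x) (k s t y))"
  then have B [measurable]: "B \<in> sets borel"
    by (simp add: conv_meas_def)
  interpret y: prob_space "k s t y" by (rule prob_space_k)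
  have "emeasure (conv_meas (k s t x) (k s t y)) B
      = (\<integral>\<^sup>+ a. \<integral>\<^sup>+ b. indicator B (a + b) \<partial>k s t y \<partial>k s t x)"
    by (intro emeasure_conv_meas prob_space_k B) auto
  also have "\<dots> = (\<integral>\<^sup>+ i. \<integral>\<^sup>+ b. indicator B (x + ennreal_of_enat i + b) \<partial>k s t y \<partial>measure_pmf (q s t (enn2real x)))"
    using x by (intro nn_integral_k) measurable
  also have "\<dots> = (\<integral>\<^sup>+ i. \<integral>\<^sup>+ j. indicator B (x + ennreal_of_enat i + (y + ennreal_of_enat j))
      \<partial>measure_pmf (q s t (enn2real y)) \<partial>measure_pmf (q s t (enn2real x)))"
    using y by (intro nn_integral_cong nn_integral_k) measurable
  also have "\<dots> = (\<integral>\<^sup>+ z. indicator {n. x + y + ennreal_of_enat n \<in> B} (fst z + snd z)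
      \<partial>measure_pmf (pair_pmf (q s t (enn2real x)) (q s t (enn2real y))))"
    by (simp add: nn_integral_pair_pmf' indicator_def ennreal_of_enat_plus add_ac)
  also have "\<dots> = (\<integral>\<^sup>+ n. indicator {n. x + y + ennreal_of_enat n \<in> B} n
      \<partial>measure_pmf (conv_pmf (q s t (enn2real x)) (q s t (enn2real y))))"
    by (simp add: conv_pmf_def case_prod_unfold del: nn_integral_indicator)
  also have "conv_pmf (q s t (enn2real x)) (q s t (enn2real y)) = q s t (enn2real (x + y))"
    using x y st by (simp add: q_add enn2real_plus less_top)
  also have "(\<integral>\<^sup>+ n. indicator {n. x + y + ennreal_of_enat n \<in> B} n \<partial>measure_pmf (q s t (enn2real (x + y))))
      = emeasure (k s t (x + y)) B"
    using x y B by (simp add: emeasure_k)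
  finally show "emeasure (conv_meas (k s t x) (k s t y)) B = emeasure (k s t (x + y)) B" .
qed (simp add: conv_meas_def)

lemma k_of_enat:
  assumes st: "(s, t) \<in> Delta" and B: "B \<in> sets borel"
  shows "emeasure (k s t (ennreal_of_enat n)) B = emeasure (measure_pmf (l s t n)) {m. ennreal_of_enat m \<in> B}"
proof (cases n)
  case (enat m)
  then show ?thesis
    using st B by (simp add: enn2real_of_nat emeasure_k kernel_eq_map_q vimage_def ennreal_of_enat_plus)
qed (use st B in \<open>simp add: kernel_infinity[OF kernels] indicator_def\<close>)

lemma k_0:
  assumes "(s, t) \<in> Delta"
  shows "k s t 0 = return borel 0"
proof (rule measure_eqI)
  fix B assume "B \<in> sets (k s t 0)"
  then show "emeasure (k s t 0) B = emeasure (return borel 0) B"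
    using k_of_enat[OF assms, of B 0] kernel_0[OF kernels assms] by (simp add: indicator_def)
qed simp

end

section \<open>Weak continuity of the embedding kernels\<close>

lemma continuous_on_enn2real:
  assumes "continuous_on S g" "\<And>x. x \<in> S \<Longrightarrow> g x \<noteq> top"
  shows "continuous_on S (\<lambda>x. enn2real (g x))"
  unfolding continuous_on_def
proof
  fix x assume x: "x \<in> S"
  have "(g \<longlongrightarrow> ennreal (enn2real (g x))) (at x within S)"
    using assms x by (simp add: continuous_on_def less_top)
  then show "((\<lambda>x. enn2real (g x)) \<longlongrightarrow> enn2real (g x)) (at x within S)"
    by (rule tendsto_enn2real) simp
qed

lemma continuous_ennreal_near_top:
  fixes f :: "ennreal \<Rightarrow> real"
  assumes "continuous_on UNIV f" "0 < e"
  obtains N :: nat where "\<And>y. of_nat N \<le> y \<Longrightarrow> \<bar>f y - f top\<bar> < e"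
proof -
  have "open (f -` ball (f top) e)"
    using assms by (intro open_vimage) auto
  then obtain b where b: "b < top" "{b<..top} \<subseteq> f -` ball (f top) e"
    using open_left[of "f -` ball (f top) e" top 0] assms by auto
  obtain N where "b < of_nat N"
    using b(1) ennreal_Ex_less_of_nat by auto
  have "\<bar>f y - f top\<bar> < e" if "of_nat N \<le> y" for y
  proof -
    have "b < y"
      using \<open>b < of_nat N\<close> that by (rule less_le_trans)
    then have "f y \<in> ball (f top) e"
      using b(2) by auto
    then show ?thesis
      by (simp add: dist_real_def abs_minus_commute)
  qed
  then show ?thesis using that by blast
qed

context immortal_branching
begin

text \<open>The integral is a uniform limit of finite sums. \<open>J N\<close> replaces
  \<open>f\<close> by its value at infinity on all increments above \<open>N\<close>. The error is
  uniform in \<open>s\<close>, \<open>t\<close>, \<open>x\<close>, since such an increment moves the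
  population beyond \<open>N\<close>, where \<open>f\<close> is close to
  \<open>f top\<close>.\<close>

lemma k_continuous:
  fixes f :: "ennreal \<Rightarrow> real"
  assumes f: "continuous_on UNIV f"
  shows "continuous_on {(s, t, x). (s, t) \<in> Delta \<and> x \<noteq> \<infinity>} (\<lambda>(s, t, x). \<integral>y. f y \<partial>k s t x)"
proof -
  let ?S = "{(s, t, x :: ennreal). (s, t) \<in> Delta \<and> x \<noteq> \<infinity>}"
  define J where "J N z = f top + (\<Sum>n\<le>N. R (fst z) (fst (snd z)) (enn2real (snd (snd z))) $ n
      * (f (snd (snd z) + of_nat n) - f top))" for N and z :: "real \<times> real \<times> ennreal"
  have f_meas: "f \<in> borel_measurable borel"
    using f by (rule borel_measurable_continuous_onI)
  \<comment> \<open>The space \<open>ennreal\<close> is compact, so \<open>f\<close> is bounded and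
    all integrals below exist.\<close>
  have "compact (range f)"
    using f compact_UNIV by (rule compact_continuous_image)
  then obtain C where C: "\<And>y. \<bar>f y\<bar> \<le> C"
    using bounded_iff compact_imp_bounded by (metis rangeI real_norm_def)
  have R: "continuous_on ?S (\<lambda>z. R (fst z) (fst (snd z)) (enn2real (snd (snd z))) $ n)" for n
  proof -
    have "continuous_on ?S ((\<lambda>(s, t, x). R s t x $ n) \<circ> (\<lambda>z. (fst z, fst (snd z), enn2real (snd (snd z)))))"
      by (intro continuous_on_compose continuous_on_subset[OF R_continuous] continuous_intros
          continuous_on_enn2real) auto
    then show ?thesis by (simp add: o_def)
  qed
  have fn: "continuous_on ?S (\<lambda>z. f (snd (snd z) + of_nat n))" for n
    by (rule continuous_on_compose2[OF f]) (auto intro!: continuous_intros continuous_on_add_ennreal)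
  have J: "continuous_on ?S (J N)" for N
    unfolding J_def by (intro continuous_intros R fn)
  have approx: "\<bar>J N (s, t, x) - (\<integral>y. f y \<partial>k s t x)\<bar> \<le> e"
    if st: "(s, t) \<in> Delta" and x: "x \<noteq> \<infinity>"
      and N: "\<And>y. of_nat N \<le> y \<Longrightarrow> \<bar>f y - f top\<bar> < e" for N s t x e
  proof -
    let ?q = "measure_pmf (q s t (enn2real x))"
    define g where "g i = f (x + ennreal_of_enat i) - f top" for i
    define A where "A = enat ` {..N}"
    have bound: "\<bar>g i\<bar> \<le> 2 * C" for i
      using C[of "x + ennreal_of_enat i"] C[of top] by (simp add: g_def)
    have int: "integrable ?q (\<lambda>i. g i * indicator B i)" for B
      using bound order_trans[OF abs_ge_zero bound]
      by (intro measure_pmf.integrable_const_bound[where B="2 * C"]) (auto simp: indicator_def)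
    have "(\<integral>y. f y \<partial>k s t x) = (\<integral>i. f (x + ennreal_of_enat i) \<partial>?q)"
      using x f_meas by (simp add: k_def integral_distr)
    also have "\<dots> = (\<integral>i. f top + (g i * indicator A i + g i * indicator (- A) i) \<partial>?q)"
      by (intro Bochner_Integration.integral_cong) (auto simp: g_def indicator_def)
    also have "\<dots> = f top + ((\<integral>i. g i * indicator A i \<partial>?q) + (\<integral>i. g i * indicator (- A) i \<partial>?q))"
      by (simp add: int)
    also have "(\<integral>i. g i * indicator A i \<partial>?q) = (\<Sum>i\<in>A. g i * indicator A i * pmf (q s t (enn2real x)) i)"
      by (rule integral_measure_pmf_real) (auto simp: A_def indicator_def split: if_splits)
    also have "\<dots> = (\<Sum>n\<le>N. R s t (enn2real x) $ n * (f (x + of_nat n) - f top))"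
      using st by (simp add: A_def sum.reindex inj_on_def g_def pmf_q mult_ac)
    finally have eq: "(\<integral>y. f y \<partial>k s t x) = J N (s, t, x) + (\<integral>i. g i * indicator (- A) i \<partial>?q)"
      by (simp add: J_def)
    have "0 < e"
      using N[of top] by simp
    have "\<bar>g i * indicator (- A) i\<bar> \<le> e" for i
    proof (cases "i \<in> A")
      case False
      have "ennreal_of_enat (enat N) \<le> ennreal_of_enat i"
        using False by (subst ennreal_of_enat_le_iff) (cases i, auto simp: A_def)
      also have "\<dots> \<le> x + ennreal_of_enat i" by simp
      finally show ?thesis
        using N[of "x + ennreal_of_enat i"] False by (simp add: g_def)
    qed (use \<open>0 < e\<close> in simp)
    then have "(\<integral>i. \<bar>g i * indicator (- A) i\<bar> \<partial>?q) \<le> (\<integral>i. e \<partial>?q)"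
      using int by (intro integral_mono) auto
    then have "\<bar>\<integral>i. g i * indicator (- A) i \<partial>?q\<bar> \<le> e"
      by (intro order_trans[OF integral_abs_bound]) simp
    then show ?thesis using eq by simp
  qed
  have "uniform_limit ?S J (\<lambda>(s, t, x). \<integral>y. f y \<partial>k s t x) sequentially"
  proof (rule uniform_limitI)
    fix e :: real assume "0 < e"
    then obtain N where N: "\<And>y. of_nat N \<le> y \<Longrightarrow> \<bar>f y - f top\<bar> < e / 2"
      using continuous_ennreal_near_top[OF f, of "e / 2"] by auto
    have "dist (J n z) (case z of (s, t, x) \<Rightarrow> \<integral>y. f y \<partial>k s t x) < e" if "N \<le> n" "z \<in> ?S" for n z
    proof -
      obtain s t x where z: "z = (s, t, x)" by (cases z)
      have "\<bar>f y - f top\<bar> < e / 2" if "of_nat n \<le> y" for y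
        using \<open>N \<le> n\<close> that by (intro N order_trans[OF _ that]) simp
      then have "\<bar>J n (s, t, x) - (\<integral>y. f y \<partial>k s t x)\<bar> \<le> e / 2"
        using that z by (intro approx) auto
      then show ?thesis
        using z \<open>0 < e\<close> by (simp add: dist_real_def)
    qed
    then show "\<forall>\<^sub>F n in sequentially. \<forall>z\<in>?S.
        dist (J n z) (case z of (s, t, x) \<Rightarrow> \<integral>y. f y \<partial>k s t x) < e"
      unfolding eventually_sequentially by blast
  qed
  then show ?thesis
    by (rule uniform_limit_theorem[rotated]) (simp, intro always_eventually allI J)
qed

lemma embeddable: "spatially_embeddable l"
  unfolding spatially_embeddable_def branching_kernels_ennreal_def
proof (intro exI[of _ k] conjI allI impI)
  show "conv_meas (k s t x) (k s t y) = k s t (x + y)"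
    if "(s, t) \<in> Delta" "x \<noteq> \<infinity>" "y \<noteq> \<infinity>" for s t x y
    using that by (rule k_conv)
  show "k s t \<infinity> = return borel \<infinity>" for s t
    by simp
  show "continuous_on {(s, t, x). (s, t) \<in> Delta \<and> x \<noteq> \<infinity>} (\<lambda>(s, t, x). \<integral>y. f y \<partial>k s t x)"
    if "continuous_on UNIV f" for f :: "ennreal \<Rightarrow> real"
    using that by (rule k_continuous)
qed (simp_all add: prob_space_k k_measurable k_refl k_Chapman_Kolmogorov k_0 k_of_enat)

end

section \<open>Embeddable processes cannot die out\<close>

text \<open>A tent with peak 1 at \<open>1 / 2\<close> that vanishes at every lattice point. The cap
  at 2 keeps the argument of \<open>enn2real\<close> finite, where it is continuous.\<close>

definition bump :: "ennreal \<Rightarrow> real" where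
  "bump y = max 0 (1 - 2 * \<bar>enn2real (min y 2) - 1 / 2\<bar>)"

lemma bump_continuous: "continuous_on UNIV bump"
  unfolding bump_def
  by (intro continuous_intros continuous_on_enn2real continuous_on_min) (auto simp: min_def top_unique)

lemma bump_half: "bump (ennreal (1 / 2)) = 1"
proof -
  have "min (ennreal (1 / 2)) 2 = ennreal (1 / 2)"
    using ennreal_leI[of "1 / 2" 2] by (intro min_absorb1) simp
  then show ?thesis
    unfolding bump_def by (simp only: enn2real_ennreal) simp
qed

lemma bump_of_enat: "bump (ennreal_of_enat i) = 0"
proof (cases "i \<le> 1")
  case True
  then have "i = 0 \<or> i = 1"
    by (cases i) (auto simp: zero_enat_def one_enat_def)
  moreover have "min (1 :: ennreal) 2 = 1"
    by (intro min_absorb1) simp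
  ultimately show ?thesis
    by (auto simp: bump_def)
next
  case False
  then have "enat 2 \<le> i"
    by (cases i) (auto simp: one_enat_def)
  then have "ennreal_of_enat (enat 2) \<le> ennreal_of_enat i"
    by (simp only: ennreal_of_enat_le_iff)
  then have "min (ennreal_of_enat i) 2 = 2"
    by (intro min_absorb2) simp
  then show ?thesis by (simp add: bump_def)
qed

lemma range_ennreal_of_enat_borel: "range ennreal_of_enat \<in> sets borel"
  by (rule sets.countable) auto

text \<open>If a lattice-valued sum of two independent copies of a law charges 0, then so does each copy,
  and adding 0 to the other copy shows that the law itself is carried by the lattice.\<close>

lemma AE_enat_of_conv_meas:
  assumes M: "prob_space M" and sets: "sets M = sets borel"
    and pos: "emeasure (conv_meas M M) {0} \<noteq> 0"
    and null: "emeasure (conv_meas M M) (- range ennreal_of_enat) = 0"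
  shows "AE y in M. y \<in> range ennreal_of_enat"
proof -
  interpret prob_space M by fact
  let ?B = "- range ennreal_of_enat"
  have B: "?B \<in> sets borel"
    using range_ennreal_of_enat_borel by (rule borel_comp)
  have M0: "emeasure M {0} \<noteq> 0"
  proof
    assume 0: "emeasure M {0} = 0"
    have "emeasure (conv_meas M M) {0} = (\<integral>\<^sup>+ x. \<integral>\<^sup>+ y. indicator {0} (x + y) \<partial>M \<partial>M)"
      by (intro emeasure_conv_meas M sets) auto
    also have "\<dots> \<le> (\<integral>\<^sup>+ x. \<integral>\<^sup>+ y. indicator {0} x \<partial>M \<partial>M)"
      by (intro nn_integral_mono) (auto simp: indicator_def)
    also have "\<dots> = 0"
      using 0 by (simp add: emeasure_space_1 sets)
    finally show False using pos by simp
  qed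
  have "emeasure M {0} * emeasure M ?B = (\<integral>\<^sup>+ x. emeasure M ?B * indicator {0} x \<partial>M)"
    by (subst nn_integral_cmult_indicator) (auto simp: sets mult.commute)
  also have "\<dots> \<le> (\<integral>\<^sup>+ x. \<integral>\<^sup>+ y. indicator ?B (x + y) \<partial>M \<partial>M)"
    using B by (intro nn_integral_mono) (auto simp: indicator_eq_0_iff sets split: split_indicator)
  also have "\<dots> = 0"
    using null by (simp add: emeasure_conv_meas[OF M M sets sets B])
  finally have "emeasure M ?B = 0"
    using M0 by simp
  then show ?thesis
    using B by (intro AE_I[where N="?B"]) (auto simp: sets)
qed

lemma embeddable_imp_no_death:
  assumes l: "branching_kernels_enat l" and emb: "spatially_embeddable l" and st: "(s, t) \<in> Delta"
  shows "pgf (l s t 1) 0 = 0"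
proof (rule ccontr)
  assume "pgf (l s t 1) 0 \<noteq> 0"
  then have t: "pmf (l s t 1) 0 \<noteq> 0"
    by (simp add: pgf_0_eq)
  have s: "0 \<le> s" "s \<le> t"
    using st by (auto simp: Delta_iff)
  obtain k where k: "branching_kernels_ennreal k"
    and k_l: "\<And>s t n B. (s, t) \<in> Delta \<Longrightarrow> B \<in> sets borel \<Longrightarrow>
      emeasure (k s t (ennreal_of_enat n)) B = emeasure (measure_pmf (l s t n)) {m. ennreal_of_enat m \<in> B}"
    using emb unfolding spatially_embeddable_def by blast
  let ?h = "ennreal (1 / 2)"
  have half: "?h + ?h = ennreal_of_enat 1"
    using ennreal_plus[of "1 / 2" "1 / 2"] by (simp only: ennreal_of_enat_1) simp
  \<comment> \<open>When death is possible between \<open>v\<close> and \<open>u\<close>, the law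
    started from \<open>1 / 2\<close> is carried by the lattice, where \<open>bump\<close>
    vanishes.\<close>
  have integral_0: "(\<integral>y. bump y \<partial>k v u ?h) = 0"
    if vu: "(v, u) \<in> Delta" and pos: "pmf (l v u 1) 0 \<noteq> 0" for v u
  proof -
    have M: "prob_space (k v u ?h)" "sets (k v u ?h) = sets borel"
      using k vu unfolding branching_kernels_ennreal_def by auto
    have conv: "conv_meas (k v u ?h) (k v u ?h) = k v u (ennreal_of_enat 1)"
      using k vu half unfolding branching_kernels_ennreal_def by fastforce
    have "{m. ennreal_of_enat m \<in> {0}} = {0}"
      using ennreal_of_enat_inj[of _ 0] by auto
    then have "emeasure (conv_meas (k v u ?h) (k v u ?h)) {0} \<noteq> 0"
      unfolding conv k_l[OF vu borel_singleton[OF sets.empty_sets]]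
      using pos by (simp add: emeasure_pmf_single)
    moreover have "emeasure (conv_meas (k v u ?h) (k v u ?h)) (- range ennreal_of_enat) = 0"
      unfolding conv by (subst k_l[OF vu]) (auto intro!: borel_comp range_ennreal_of_enat_borel)
    ultimately have "AE y in k v u ?h. y \<in> range ennreal_of_enat"
      by (rule AE_enat_of_conv_meas[OF M])
    then show ?thesis
      by (intro integral_eq_zero_AE) (auto simp: bump_of_enat elim!: eventually_mono)
  qed
  have "continuous_on {s..t} ((\<lambda>(s, t). pmf (l s t (enat 1)) (enat 0)) \<circ> (\<lambda>u. (s, u)))"
    using s
    by (intro continuous_on_compose continuous_intros continuous_on_subset[OF pmf_kernel_continuous[OF l]])
       (auto simp: Delta_iff)
  then have cont: "continuous_on {s..t} (\<lambda>u. pmf (l s u 1) 0)"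
    by (simp add: o_def one_enat_def zero_enat_def)
  \<comment> \<open>The times without death form a compact set containing \<open>s\<close>; its
    maximum is the critical time \<open>v\<close>.\<close>
  define A where "A = {u \<in> {s..t}. pmf (l s u 1) 0 = 0}"
  have "closed A"
    unfolding A_def using cont by (rule continuous_closed_preimage_constant) simp
  moreover have "{s..t} \<inter> A = A"
    by (auto simp: A_def)
  ultimately have "compact A"
    using compact_Int_closed[of "{s..t}" A] by simp
  moreover have "s \<in> A"
    using s by (simp add: A_def kernel_refl[OF l])
  then have "A \<noteq> {}"
    by blast
  ultimately have "\<exists>v\<in>A. \<forall>u\<in>A. u \<le> v"
    by (rule compact_attains_sup)
  then obtain v where "v \<in> A" and max: "\<forall>u\<in>A. u \<le> v" ..
  from \<open>v \<in> A\<close> have v: "s \<le> v" "v \<le> t" "pmf (l s v 1) 0 = 0"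
    by (simp_all add: A_def)
  have v_max: "u \<le> v" if "s \<le> u" "u \<le> t" "pmf (l s u 1) 0 = 0" for u
    using max that by (simp add: A_def)
  have "v < t"
    using v t by (cases "v = t") auto
  \<comment> \<open>If no death were possible between \<open>v\<close> and \<open>u\<close>,
    extinction by \<open>u\<close> would require extinction by \<open>v\<close>, which has
    probability 0. Then \<open>u\<close> would belong to \<open>A\<close>, against the maximality of
    \<open>v\<close>.\<close>
  have after: "pmf (l v u 1) 0 \<noteq> 0" if u: "v < u" "u \<le> t" for u
  proof
    assume 0: "pmf (l v u 1) 0 = 0"
    have vu: "(v, u) \<in> Delta"
      using u s v by (simp add: Delta_iff)
    have "pmf (l s u 1) (enat 0) = (\<Sum>i=0..0. pmf (l s v 1) (enat i) * pmf (l v u (enat i)) (enat 0))"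
      unfolding kernel_bind[OF l s(1) v(1) less_imp_le[OF u(1)]]
      using pmf_kernel_eq_0_of_less[OF l vu, of 0] 0
      by (intro pmf_bind_enat) (auto simp: kernel_infinity[OF l vu] pgf_0_eq)
    then have "pmf (l s u 1) 0 = 0"
      using v(3) by (simp add: zero_enat_def)
    then show False
      using v_max[of u] u v by simp
  qed
  \<comment> \<open>This function is continuous on \<open>[v, t]\<close> and vanishes right of
    \<open>v\<close>, hence also at \<open>v\<close>. There, however, the law is the point mass at
    \<open>1 / 2\<close>, which gives the value 1.\<close>
  let ?\<phi> = "\<lambda>u. \<integral>y. bump y \<partial>k v u ?h"
  have "continuous_on {(s, t, x). (s, t) \<in> Delta \<and> x \<noteq> \<infinity>} (\<lambda>(s, t, x). \<integral>y. bump y \<partial>k s t x)"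
    using k bump_continuous unfolding branching_kernels_ennreal_def by blast
  then have "continuous_on {v..t} ((\<lambda>(s, t, x). \<integral>y. bump y \<partial>k s t x) \<circ> (\<lambda>u. (v, u, ?h)))"
    using s v
    by (intro continuous_on_compose continuous_intros) (auto simp: Delta_iff elim: continuous_on_subset)
  then have "continuous_on (closure {v<..t}) ?\<phi>"
    using \<open>v < t\<close> by (simp add: o_def)
  then have "?\<phi> v = 0"
    by (rule continuous_constant_on_closure)
       (use \<open>v < t\<close> s v after integral_0 in \<open>auto simp: Delta_iff\<close>)
  moreover have "k v v ?h = return borel ?h"
    using k s v unfolding branching_kernels_ennreal_def by simp
  ultimately show False
    using borel_measurable_continuous_onI[OF bump_continuous] bump_half by (simp add: integral_return)
qed

section \<open>Path monotonicity\<close>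

text \<open>The Markov property is applied to the event \<open>N t = i\<close>, on which the
  transition probability is the constant \<open>pmf (l t u i) j\<close>.\<close>

lemma markov_joint_distribution:
  assumes M: "markov_family \<Omega> N P l" and "0 \<le> s" "s \<le> t" "t \<le> u"
  shows "measure (P s n) {\<omega> \<in> space \<Omega>. N t \<omega> = i \<and> N u \<omega> = j}
    = measure (P s n) {\<omega> \<in> space \<Omega>. N t \<omega> = i} * pmf (l t u i) j"
proof -
  let ?A = "{\<omega> \<in> space \<Omega>. N t \<omega> = i}"
  have P: "prob_space (P s n)" "sets (P s n) = sets \<Omega>"
    using M assms unfolding markov_family_def by auto
  interpret prob_space "P s n" by fact
  have "N t \<in> measurable \<Omega> (count_space UNIV)"
    using M assms unfolding markov_family_def by auto
  then have A: "?A \<in> sets (P s n)"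
    unfolding P(2) by measurable
  have "N t -` {i} \<inter> space \<Omega> \<in> sets (filt \<Omega> N s t)"
    unfolding filt_def using assms by (subst sets_measure_of) (auto intro!: sigma_sets.Basic)
  moreover have "N t -` {i} \<inter> space \<Omega> = ?A"
    by auto
  ultimately have "?A \<in> sets (filt \<Omega> N s t)"
    by simp
  then have "measure (P s n) (?A \<inter> {\<omega> \<in> space \<Omega>. N u \<omega> \<in> {j}})
      = (\<integral>\<omega>. indicator ?A \<omega> * measure_pmf.prob (l t u (N t \<omega>)) {j} \<partial>P s n)"
    by (rule M[unfolded markov_family_def, THEN conjunct2, THEN conjunct2, rule_format, OF assms(2-4)])
  also have "\<dots> = (\<integral>\<omega>. indicator ?A \<omega> * pmf (l t u i) j \<partial>P s n)"
    by (intro Bochner_Integration.integral_cong) (auto simp: indicator_def measure_pmf_single)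
  also have "\<dots> = measure (P s n) ?A * pmf (l t u i) j"
    using A by simp
  also have "?A \<inter> {\<omega> \<in> space \<Omega>. N u \<omega> \<in> {j}} = {\<omega> \<in> space \<Omega>. N t \<omega> = i \<and> N u \<omega> = j}"
    by auto
  finally show ?thesis .
qed

lemma sets_Collect_enat_le:
  fixes f g :: "'a \<Rightarrow> enat"
  assumes [measurable]: "f \<in> measurable M (count_space UNIV)" "g \<in> measurable M (count_space UNIV)"
  shows "{\<omega> \<in> space M. f \<omega> \<le> g \<omega>} \<in> sets M"
proof -
  have "{\<omega> \<in> space M. f \<omega> \<le> g \<omega>} = (\<Union>i. (f -` {i} \<inter> space M) \<inter> (g -` {i..} \<inter> space M))"
    by auto
  also have "\<dots> \<in> sets M"
    by (intro sets.countable_UN' sets.Int measurable_sets[OF assms(1)] measurable_sets[OF assms(2)]) auto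
  finally show ?thesis .
qed

text \<open>From left to right, a decrease is a countable union of events \<open>N t = i\<close>,
  \<open>N u = j\<close> with \<open>j < i\<close>, each of them null. Conversely, monotonicity
  between the starting time and \<open>t\<close> suffices, because the process starts from
  \<open>n\<close> almost surely.\<close>

lemma monotone_paths_iff:
  assumes M: "markov_family \<Omega> N P l" and l: "branching_kernels_enat l"
  shows "(\<forall>s t m n. (s, t) \<in> Delta \<longrightarrow> m < n \<longrightarrow> pmf (l s t (enat n)) (enat m) = 0) \<longleftrightarrow>
    (\<forall>s t u n. 0 \<le> s \<longrightarrow> s \<le> t \<longrightarrow> t \<le> u \<longrightarrow>
       measure (P s (enat n)) {\<omega> \<in> space \<Omega>. N t \<omega> \<le> N u \<omega>} = 1)" (is "?L \<longleftrightarrow> ?R")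
proof
  assume L: ?L
  show ?R
  proof (intro allI impI)
    fix s t u n assume stu: "0 \<le> s" "s \<le> t" "t \<le> (u :: real)"
    then have tu: "(t, u) \<in> Delta"
      by (simp add: Delta_iff)
    have P: "prob_space (P s (enat n))" "sets (P s (enat n)) = sets \<Omega>"
      using M stu unfolding markov_family_def by auto
    interpret prob_space "P s (enat n)" by fact
    have sp: "space (P s (enat n)) = space \<Omega>"
      using P(2) by (rule sets_eq_imp_space_eq)
    note [measurable_cong] = P(2)
    have [measurable]: "N t \<in> measurable \<Omega> (count_space UNIV)" "N u \<in> measurable \<Omega> (count_space UNIV)"
      using M stu unfolding markov_family_def by auto
    have zero: "AE \<omega> in P s (enat n). \<not> (N t \<omega> = i \<and> N u \<omega> = j)" if "j < i" for i j
    proof -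
      \<comment> \<open>For finite \<open>i\<close> this is the hypothesis; for infinite
        \<open>i\<close> it holds because infinity is absorbing.\<close>
      have "pmf (l t u i) j = 0"
        using that L tu kernel_infinity[OF l tu] by (cases i; cases j) auto
      then have "prob {\<omega> \<in> space (P s (enat n)). N t \<omega> = i \<and> N u \<omega> = j} = 0"
        using markov_joint_distribution[OF M stu] sp by simp
      then show ?thesis
        by (subst (asm) prob_Collect_eq_0) auto
    qed
    have "AE \<omega> in P s (enat n). \<forall>i j. j < i \<longrightarrow> \<not> (N t \<omega> = i \<and> N u \<omega> = j)"
      unfolding AE_all_countable using zero by auto
    then have "AE \<omega> in P s (enat n). N t \<omega> \<le> N u \<omega>"
      by eventually_elim (auto simp: not_less[symmetric])
    then have "prob {\<omega> \<in> space (P s (enat n)). N t \<omega> \<le> N u \<omega>} = 1"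
      by (subst prob_Collect_eq_1) (auto intro!: sets_Collect_enat_le)
    then show "prob {\<omega> \<in> space \<Omega>. N t \<omega> \<le> N u \<omega>} = 1"
      by (simp add: sp)
  qed
next
  assume R: ?R
  show ?L
  proof (intro allI impI)
    fix s t and m n :: nat assume st: "(s, t) \<in> Delta" and "m < n"
    then have s: "0 \<le> s" "s \<le> s" "s \<le> t"
      by (auto simp: Delta_iff)
    have P: "prob_space (P s (enat n))" "sets (P s (enat n)) = sets \<Omega>"
      and start: "measure (P s (enat n)) {\<omega> \<in> space \<Omega>. N s \<omega> = enat n} = 1"
      using M s unfolding markov_family_def by auto
    interpret prob_space "P s (enat n)" by fact
    have sp: "space (P s (enat n)) = space \<Omega>"
      using P(2) by (rule sets_eq_imp_space_eq)
    note [measurable_cong] = P(2)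
    have [measurable]: "N t \<in> measurable \<Omega> (count_space UNIV)" "N s \<in> measurable \<Omega> (count_space UNIV)"
      using M s unfolding markov_family_def by auto
    have "prob {\<omega> \<in> space (P s (enat n)). N s \<omega> \<le> N t \<omega>} = 1"
      using R s sp by simp
    then have "AE \<omega> in P s (enat n). N s \<omega> \<le> N t \<omega>"
      by (subst (asm) prob_Collect_eq_1) (auto intro!: sets_Collect_enat_le)
    then have "AE \<omega> in P s (enat n). \<not> (N s \<omega> = enat n \<and> N t \<omega> = enat m)"
      by eventually_elim (use \<open>m < n\<close> in auto)
    then have "prob {\<omega> \<in> space (P s (enat n)). N s \<omega> = enat n \<and> N t \<omega> = enat m} = 0"
      by (subst prob_Collect_eq_0) auto
    then show "pmf (l s t (enat n)) (enat m) = 0"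
      using markov_joint_distribution[OF M s, of "enat n" "enat n" "enat m"] start sp by simp
  qed
qed

theorem mainTheorem19:
  fixes \<Omega> :: "'w measure" and N :: "real \<Rightarrow> 'w \<Rightarrow> enat"
    and P :: "real \<Rightarrow> enat \<Rightarrow> 'w measure" and l :: "real \<Rightarrow> real \<Rightarrow> enat \<Rightarrow> enat pmf"
  assumes "branching_process \<Omega> N P l"
  shows "(spatially_embeddable l \<longleftrightarrow> (\<forall>s t. (s, t) \<in> Delta \<longrightarrow> pgf (l s t 1) 0 = 0))
    \<and> ((\<forall>s t. (s, t) \<in> Delta \<longrightarrow> pgf (l s t 1) 0 = 0) \<longleftrightarrow>
         (\<forall>s t m n. (s, t) \<in> Delta \<longrightarrow> m < n \<longrightarrow> pmf (l s t (enat n)) (enat m) = 0))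
    \<and> ((\<forall>s t m n. (s, t) \<in> Delta \<longrightarrow> m < n \<longrightarrow> pmf (l s t (enat n)) (enat m) = 0) \<longleftrightarrow>
         (\<forall>s t u n. 0 \<le> s \<longrightarrow> s \<le> t \<longrightarrow> t \<le> u \<longrightarrow>
            measure (P s (enat n)) {\<omega> \<in> space \<Omega>. N t \<omega> \<le> N u \<omega>} = 1))"
proof -
  have M: "markov_family \<Omega> N P l" and l: "branching_kernels_enat l"
    using assms by (auto simp: branching_process_def)
  show ?thesis
  proof (intro conjI)
    show "spatially_embeddable l \<longleftrightarrow> (\<forall>s t. (s, t) \<in> Delta \<longrightarrow> pgf (l s t 1) 0 = 0)"
      using embeddable_imp_no_death[OF l] immortal_branching.embeddable[of l] l
      by (auto simp: immortal_branching_def)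
    show "(\<forall>s t. (s, t) \<in> Delta \<longrightarrow> pgf (l s t 1) 0 = 0) \<longleftrightarrow>
         (\<forall>s t m n. (s, t) \<in> Delta \<longrightarrow> m < n \<longrightarrow> pmf (l s t (enat n)) (enat m) = 0)"
    proof
      assume *: "\<forall>s t m n. (s, t) \<in> Delta \<longrightarrow> m < n \<longrightarrow> pmf (l s t (enat n)) (enat m) = 0"
      show "\<forall>s t. (s, t) \<in> Delta \<longrightarrow> pgf (l s t 1) 0 = 0"
        \<comment> \<open>Extinction of a single individual is the case \<open>m = 0\<close>,
          \<open>n = 1\<close>.\<close>
        using *[rule_format, of _ _ 0 1] by (simp add: pgf_0_eq zero_enat_def one_enat_def)
    qed (use pmf_kernel_eq_0_of_less[OF l] in blast)
  qed (rule monotone_paths_iff[OF M l])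
qed

end
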